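(* For all positive integers $s,t$ with $3\le s\le t-1$, $\mathrm{ex}\big(n,(K_{s+1,t}^+)^{\mathrm{sub}}\big)=O\!\left(n^{1+\frac{s^2+1}{2s+2s^2}}\right)$; that is, there is a constant $C=C(s,t)$ such that every $n$-vertex graph not containing $(K_{s+1,t}^+)^{\mathrm{sub}}$ as a subgraph has at most $C\,n^{1+\frac{s^2+1}{2s+2s^2}}$ edges.
   Context: $\mathrm{ex}(n,F)$ denotes the maximum number of edges of an $n$-vertex graph containing no (not necessarily induced) subgraph isomorphic to $F$. $K_{s+1,t}^+$ is the graph obtained from a copy of the complete bipartite graph $K_{s,t}$ (with parts of sizes $s$ and $t$) by adding one new vertex $r$ joined to exactly one vertex of the $s$-part and to all vertices of the $t$-part. For a graph $H$, $H^{\mathrm{sub}}$ denotes its $1$-subdivision, obtained by replacing each edge by a path of length two. *)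

theory Defs
  imports Complex_Main "HOL-Library.Landau_Symbols"
begin

record 'a graph =
  verts :: "'a set"
  edges :: "'a set set"

definition simple_graph :: "'a graph \<Rightarrow> bool" where
  "simple_graph G \<longleftrightarrow> finite (verts G) \<and> (\<forall>e\<in>edges G. e \<subseteq> verts G \<and> card e = 2)"

text \<open>Containment as a not necessarily induced subgraph, up to isomorphism.\<close>

definition contains_copy :: "'a graph \<Rightarrow> 'b graph \<Rightarrow> bool" where
  "contains_copy G F \<longleftrightarrow>
     (\<exists>f. inj_on f (verts F) \<and> f ` verts F \<subseteq> verts G \<and> (\<forall>e\<in>edges F. f ` e \<in> edges G))"

text \<open>Host graphs on \<^typ>\<open>nat\<close> suffice, since every finite graph is isomorphic to one of these.
  The set is finite, and it is nonempty as soon as \<open>F\<close> has an edge (see below).\<close>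

definition ex :: "nat \<Rightarrow> 'b graph \<Rightarrow> nat" where
  "ex n F = Max {card (edges G) | G :: nat graph.
     simple_graph G \<and> card (verts G) = n \<and> \<not> contains_copy G F}"

text \<open>The old vertices are tagged \<open>Inl\<close>; the middle vertex of the path replacing \<open>e\<close> is \<open>Inr e\<close>.\<close>

definition subdivision :: "'a graph \<Rightarrow> ('a + 'a set) graph" where
  "subdivision H =
     \<lparr>verts = Inl ` verts H \<union> Inr ` edges H,
      edges = {{Inl v, Inr e} | v e. e \<in> edges H \<and> v \<in> e}\<rparr>"

datatype kvertex = SV nat | TV nat | RV

text \<open>\<open>K_plus s t\<close> is $K_{s+1,t}^+$: the vertices \<open>SV i\<close>, \<open>TV j\<close> span $K_{s,t}$, and the new vertex
  \<open>RV\<close> is joined to \<open>SV 0\<close> and to all \<open>TV j\<close>. It is meaningful for \<open>s > 0\<close>.\<close>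

definition K_plus :: "nat \<Rightarrow> nat \<Rightarrow> kvertex graph" where
  "K_plus s t =
     \<lparr>verts = SV ` {..<s} \<union> TV ` {..<t} \<union> {RV},
      edges = {{SV i, TV j} | i j. i < s \<and> j < t} \<union> {{RV, SV 0}} \<union> {{RV, TV j} | j. j < t}\<rparr>"

lemma simple_graph_K_plus: "s > 0 \<Longrightarrow> simple_graph (K_plus s t)"
  by (auto simp: simple_graph_def K_plus_def)

lemma simple_graph_subdivision:
  assumes "simple_graph H"
  shows "simple_graph (subdivision H)"
proof -
  have "edges H \<subseteq> Pow (verts H)"
    using assms by (auto simp: simple_graph_def)
  then have "finite (edges H)"
    using assms finite_subset by (auto simp: simple_graph_def)
  then show ?thesis
    using assms by (auto simp: simple_graph_def subdivision_def)
qed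

lemma finite_ex_set:
  "finite {card (edges G) | G :: 'a graph.
     simple_graph G \<and> card (verts G) = n \<and> \<not> contains_copy G F}"
proof (rule finite_subset)
  show "{card (edges G) | G :: 'a graph.
     simple_graph G \<and> card (verts G) = n \<and> \<not> contains_copy G F} \<subseteq> {..2 ^ n}"
  proof clarsimp
    fix G :: "'a graph"
    assume "simple_graph G"
    then have "edges G \<subseteq> Pow (verts G)" "finite (verts G)"
      by (auto simp: simple_graph_def)
    then show "card (edges G) \<le> 2 ^ card (verts G)"
      by (metis card_Pow card_mono finite_Pow_iff)
  qed
qed simp

lemma ex_set_nonempty:
  assumes "edges F \<noteq> {}"
  shows "{card (edges G) | G :: nat graph.
     simple_graph G \<and> card (verts G) = n \<and> \<not> contains_copy G F} \<noteq> {}"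
proof -
  have "simple_graph \<lparr>verts = {..<n}, edges = {}\<rparr> \<and>
      card (verts \<lparr>verts = {..<n}, edges = {}\<rparr>) = n \<and>
      \<not> contains_copy \<lparr>verts = {..<n}, edges = {}\<rparr> F"
    using assms by (auto simp: simple_graph_def contains_copy_def)
  then show ?thesis
    by blast
qed

lemma edges_subdivision_K_plus: "edges (subdivision (K_plus s t)) \<noteq> {}"
  by (auto simp: subdivision_def K_plus_def)

end

theory Submission
  imports Defs "HOL-Library.FuncSet"
begin

text \<open>
  Pass to a bipartite subgraph between \<open>A\<close> and \<open>B\<close> in which all degrees in \<open>B\<close> agree up to a factor of two
  and all degrees in \<open>A\<close> are at least \<open>\<delta>\<close>. Call two vertices of \<open>A\<close> light if they have few, but some, common
  neighbours. Since pairwise heavy vertices yield the subdivision greedily, the light graph has density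
  at least about \<open>p = \<delta>\<^sup>2 / n\<close> on every subset of \<open>A\<close> that is not too small.

  Count pairs of common light neighbours \<open>v, w\<close> of tuples \<open>z\<^sub>0, \<dots>, z\<^sub>s\<close> with \<open>z\<^sub>0, z\<^sub>1\<close> light. Writing \<open>d(v, w)\<close>
  for the codegree in the light graph, there are at least about \<open>p \<Sum> d(v, w)\<^sup>s\<^sup>+\<^sup>1\<close> of them, by the density applied
  to the common neighbourhoods. If the subdivision is absent, then for every tuple most of these pairs
  have clashing subdivision vertices; a clash confines one of \<open>z\<^sub>0, \<dots>, z\<^sub>s\<close> to a set of size \<open>O(\<Delta>)\<close>, where
  \<open>\<Delta>\<close> is the maximum degree in \<open>B\<close>, so there are only \<open>O(\<Delta> \<Sum> d(v, w)\<^sup>s)\<close> such pairs. As \<open>d\<close> is about \<open>p\<^sup>2 n\<close> on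
  average, this contradicts \<open>p\<^sup>3 n \<gg> \<Delta>\<close>, which holds with polynomial room to spare.
\<close>

section \<open>Double counting and power sums\<close>

lemma sum_card_swap:
  assumes "finite X" "finite Y"
  shows "(\<Sum>x\<in>X. card {y\<in>Y. P x y}) = (\<Sum>y\<in>Y. card {x\<in>X. P x y})"
proof -
  have "(\<Sum>x\<in>X. card {y\<in>Y. P x y}) = (\<Sum>x\<in>X. \<Sum>y\<in>Y. of_bool (P x y))"
    using assms by (intro sum.cong refl) (simp add: Int_def)
  also have "\<dots> = (\<Sum>y\<in>Y. \<Sum>x\<in>X. of_bool (P x y))"
    by (rule sum.swap)
  also have "\<dots> = (\<Sum>y\<in>Y. card {x\<in>X. P x y})"
    using assms by (intro sum.cong refl) (simp add: Int_def)
  finally show ?thesis .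
qed

text \<open>Chebyshev's sum inequality: \<open>f i ^ k\<close> and \<open>f i\<close> are ordered
  alike, so \<open>(f i ^ k - f j ^ k) * (f i - f j)\<close> is never negative, and its sum over all
  pairs is twice the difference of the two sides.\<close>

lemma sum_power_Suc_ge:
  fixes f :: "'b \<Rightarrow> real"
  assumes "finite I" "\<And>i. i \<in> I \<Longrightarrow> 0 \<le> f i"
  shows "(\<Sum>i\<in>I. f i ^ k) * (\<Sum>i\<in>I. f i) \<le> card I * (\<Sum>i\<in>I. f i ^ Suc k)"
proof -
  have nonneg: "0 \<le> (f i ^ k - f j ^ k) * (f i - f j)" if "i \<in> I" "j \<in> I" for i j
  proof (cases "f i \<le> f j")
    case True
    then have "f i ^ k \<le> f j ^ k" using assms that by (intro power_mono) auto
    then show ?thesis using True by (intro mult_nonpos_nonpos) auto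
  next
    case False
    then have "f j ^ k \<le> f i ^ k" using assms that by (intro power_mono) auto
    then show ?thesis using False by simp
  qed
  have "0 \<le> (\<Sum>i\<in>I. \<Sum>j\<in>I. (f i ^ k - f j ^ k) * (f i - f j))"
    by (intro sum_nonneg nonneg)
  also have "\<dots> = (\<Sum>i\<in>I. \<Sum>j\<in>I. f i ^ Suc k + f j ^ Suc k - (f i ^ k * f j + f i * f j ^ k))"
    by (intro sum.cong refl) (simp add: algebra_simps)
  also have "\<dots> = 2 * (card I * (\<Sum>i\<in>I. f i ^ Suc k)) - 2 * ((\<Sum>i\<in>I. f i ^ k) * (\<Sum>i\<in>I. f i))"
    by (simp add: sum.distrib sum_subtractf sum_distrib_left[symmetric] sum_distrib_right[symmetric]
        del: power_Suc)
  finally show ?thesis by simp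
qed

text \<open>The power mean inequality, by iterating Chebyshev's inequality.\<close>

lemma sum_power_ge:
  fixes f :: "'b \<Rightarrow> real"
  assumes "finite I" "\<And>i. i \<in> I \<Longrightarrow> 0 \<le> f i"
  shows "(\<Sum>i\<in>I. f i) ^ Suc k \<le> card I ^ k * (\<Sum>i\<in>I. f i ^ Suc k)"
proof (induction k)
  case (Suc k)
  have "(\<Sum>i\<in>I. f i) ^ Suc (Suc k) = (\<Sum>i\<in>I. f i) ^ Suc k * (\<Sum>i\<in>I. f i)"
    by simp
  also have "\<dots> \<le> card I ^ k * (\<Sum>i\<in>I. f i ^ Suc k) * (\<Sum>i\<in>I. f i)"
    by (intro mult_right_mono Suc sum_nonneg assms)
  also have "\<dots> = card I ^ k * ((\<Sum>i\<in>I. f i ^ Suc k) * (\<Sum>i\<in>I. f i))"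
    by simp
  also have "\<dots> \<le> card I ^ k * (card I * (\<Sum>i\<in>I. f i ^ Suc (Suc k)))"
    by (intro mult_left_mono sum_power_Suc_ge assms) simp_all
  finally show ?case by (simp only: power_Suc of_nat_mult of_nat_power mult_ac)
qed simp

lemma sum_squared_le:
  fixes f :: "'b \<Rightarrow> nat"
  assumes "finite I"
  shows "(\<Sum>i\<in>I. f i)\<^sup>2 \<le> card I * (\<Sum>i\<in>I. (f i)\<^sup>2)"
proof -
  have "real ((\<Sum>i\<in>I. f i)\<^sup>2) \<le> real (card I * (\<Sum>i\<in>I. (f i)\<^sup>2))"
    using sum_power_ge[OF assms, of "\<lambda>i. real (f i)" 1] by (simp add: numeral_2_eq_2)
  then show ?thesis by (simp only: of_nat_le_iff)
qed

section \<open>Distinct representatives and relations without large cliques\<close>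

text \<open>Greedy choice: when the next index is served, fewer than \<open>card I\<close> values
  are taken, so its set still has a free element.\<close>

lemma distinct_representatives:
  assumes "finite I" "\<And>i. i \<in> I \<Longrightarrow> card I \<le> card (F i)"
  shows "\<exists>h. inj_on h I \<and> (\<forall>i\<in>I. h i \<in> F i)"
proof -
  have "\<exists>h. inj_on h J \<and> (\<forall>i\<in>J. h i \<in> F i)" if "finite J" "J \<subseteq> I" for J
    using that
  proof (induction J)
    case (insert j J)
    then obtain h where h: "inj_on h J" "\<forall>i\<in>J. h i \<in> F i"
      by auto
    have "card J < card I"
      using insert assms(1) by (intro psubset_card_mono) auto
    then have "card (h ` J) < card (F j)"
      using insert.prems assms(2)[of j] card_image_le[OF insert.hyps(1), of h] by simp
    then obtain x where x: "x \<in> F j" "x \<notin> h ` J"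
      using insert.hyps(1) by (metis card_mono finite_imageI leD subsetI)
    have "inj_on (h(j := x)) (insert j J)"
      using h(1) x(2) insert.hyps(2) by (auto simp: inj_on_def)
    moreover have "\<forall>i\<in>insert j J. (h(j := x)) i \<in> F i"
      using h(2) x(1) by auto
    ultimately show ?case by blast
  qed auto
  then show ?thesis using assms(1) by blast
qed

text \<open>A weak Turan bound, by induction on the forbidden clique size \<open>q\<close>. If some
  vertex is related to at least half of \<open>Y\<close>, its neighbourhood has no clique of size
  \<open>q - 1\<close>, and halving the set costs a factor 4. Otherwise every vertex misses at least
  half of \<open>Y\<close>.\<close>

lemma card_nonadjacent_ge:
  assumes "finite Y" "symp R"
    and "\<And>Q. Q \<subseteq> Y \<Longrightarrow> card Q = q \<Longrightarrow> \<exists>u\<in>Q. \<exists>v\<in>Q. u \<noteq> v \<and> \<not> R u v"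
  shows "(card Y)\<^sup>2 \<le> 4 ^ q * card {(u, v). u \<in> Y \<and> v \<in> Y \<and> (u = v \<or> \<not> R u v)}"
  using assms(1,3)
proof (induction q arbitrary: Y)
  case 0
  \<comment> \<open>For \<open>q = 0\<close> the hypothesis fails at the empty set, so the case is
    vacuous.\<close>
  from "0.prems"(2)[of "{}"] show ?case by simp
next
  case (Suc q)
  let ?P = "\<lambda>Y. {(u, v). u \<in> Y \<and> v \<in> Y \<and> (u = v \<or> \<not> R u v)}"
  have fin: "finite (?P Y)"
    by (rule finite_subset[of _ "Y \<times> Y"]) (use Suc.prems(1) in auto)
  show ?case
  proof (cases "\<exists>v\<in>Y. card Y \<le> 2 * card {u \<in> Y. u \<noteq> v \<and> R v u}")
    case True
    then obtain v where v: "v \<in> Y" "card Y \<le> 2 * card {u \<in> Y. u \<noteq> v \<and> R v u}"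
      by blast
    let ?Y = "{u \<in> Y. u \<noteq> v \<and> R v u}"
    have "(card ?Y)\<^sup>2 \<le> 4 ^ q * card (?P ?Y)"
    proof (rule Suc.IH)
      fix Q assume Q: "Q \<subseteq> ?Y" "card Q = q"
      have "finite Q" using Q(1) Suc.prems(1) by (auto intro: finite_subset)
      moreover have "v \<notin> Q" using Q by auto
      ultimately have "card (insert v Q) = Suc q" using Q by simp
      moreover have "insert v Q \<subseteq> Y" using Q v by auto
      ultimately obtain a b where "a \<in> insert v Q" "b \<in> insert v Q" "a \<noteq> b" "\<not> R a b"
        using Suc.prems(2) by blast
      then show "\<exists>u\<in>Q. \<exists>v\<in>Q. u \<noteq> v \<and> \<not> R u v"
        using Q(1) assms(2) by (auto dest: sympD)
    qed (use Suc.prems in auto)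
    moreover have "card (?P ?Y) \<le> card (?P Y)"
      by (intro card_mono fin) auto
    moreover have "(card Y)\<^sup>2 \<le> (2 * card ?Y)\<^sup>2"
      using v(2) by (intro power_mono) auto
    ultimately show ?thesis
      by (smt (verit) le_trans mult.assoc mult_le_mono2 power2_eq_square power_Suc power_mult_distrib
          four_x_squared mult_2 numeral_Bit0)
  next
    case False
    have *: "card Y \<le> 2 * card {u \<in> Y. v = u \<or> \<not> R v u}" if "v \<in> Y" for v
    proof -
      have "card Y = card ({u \<in> Y. u \<noteq> v \<and> R v u} \<union> {u \<in> Y. v = u \<or> \<not> R v u})"
        by (intro arg_cong[of _ _ card]) auto
      also have "\<dots> \<le> card {u \<in> Y. u \<noteq> v \<and> R v u} + card {u \<in> Y. v = u \<or> \<not> R v u}"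
        by (rule card_Un_le)
      finally show ?thesis using False that by fastforce
    qed
    have "(card Y)\<^sup>2 = (\<Sum>v\<in>Y. card Y)"
      by (simp add: power2_eq_square)
    also have "\<dots> \<le> (\<Sum>v\<in>Y. 2 * card {u \<in> Y. v = u \<or> \<not> R v u})"
      by (intro sum_mono *)
    also have "\<dots> = 2 * card (SIGMA v:Y. {u \<in> Y. v = u \<or> \<not> R v u})"
      using Suc.prems(1) by (simp add: sum_distrib_left[symmetric])
    also have "(SIGMA v:Y. {u \<in> Y. v = u \<or> \<not> R v u}) = ?P Y"
      by auto
    also have "2 * card (?P Y) \<le> 4 ^ Suc q * card (?P Y)"
    proof (rule mult_right_mono)
      show "(2::nat) \<le> 4 ^ Suc q"
        using one_le_power[of "4::nat" q] by simp
    qed simp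
    finally show ?thesis .
  qed
qed

section \<open>Counting functions with constrained coordinates\<close>

text \<open>A function in \<open>S\<close> is recovered from its restriction to
  \<open>I - {j}\<close> and its value at \<open>j\<close>, and the restriction leaves at most
  \<open>x\<close> candidates for that value. Since \<open>X\<close> may depend on the restriction,
  clashes between two coordinates are covered too.\<close>

lemma card_PiE_determined_le:
  assumes "finite I" "j \<in> I" "finite U" "S \<subseteq> PiE I (\<lambda>_. U)"
    and "\<And>z. z \<in> S \<Longrightarrow> z j \<in> X (restrict z (I - {j}))"
    and "\<And>g. g \<in> PiE (I - {j}) (\<lambda>_. U) \<Longrightarrow> finite (X g) \<and> card (X g) \<le> x"
  shows "card S \<le> x * card U ^ (card I - 1)"
proof -
  let ?I = "I - {j}"
  have fin: "finite (PiE ?I (\<lambda>_. U))"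
    using assms by (intro finite_PiE) auto
  have "card S \<le> card (SIGMA g:PiE ?I (\<lambda>_. U). X g)"
  proof (rule card_inj_on_le[where f = "\<lambda>z. (restrict z ?I, z j)"])
    show "inj_on (\<lambda>z. (restrict z ?I, z j)) S"
    proof (rule inj_onI)
      fix z z' assume "z \<in> S" "z' \<in> S" and eq: "(restrict z ?I, z j) = (restrict z' ?I, z' j)"
      then have "z \<in> PiE I (\<lambda>_. U)" "z' \<in> PiE I (\<lambda>_. U)"
        using assms(4) by auto
      moreover have "z i = z' i" if "i \<in> I" for i
        using eq that by (cases "i = j") (auto dest: fun_cong[of _ _ i])
      ultimately show "z = z'" by (rule PiE_ext)
    qed
    show "(\<lambda>z. (restrict z ?I, z j)) ` S \<subseteq> (SIGMA g:PiE ?I (\<lambda>_. U). X g)"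
      using assms(4,5) by (auto simp: PiE_def Pi_def)
    show "finite (SIGMA g:PiE ?I (\<lambda>_. U). X g)"
      using fin assms(6) by (intro finite_SigmaI) auto
  qed
  also have "\<dots> = (\<Sum>g\<in>PiE ?I (\<lambda>_. U). card (X g))"
    using fin assms(6) by (intro card_SigmaI) auto
  also have "\<dots> \<le> (\<Sum>g\<in>PiE ?I (\<lambda>_. U). x)"
    using assms(6) by (intro sum_mono) auto
  also have "\<dots> = x * card U ^ (card I - 1)"
    using assms by (simp add: card_PiE mult.commute)
  finally show ?thesis .
qed

text \<open>A related pair placed at positions 0 and 1 extends by arbitrary values on
  \<open>{2..s}\<close>, which are \<open>s - 1\<close> positions.\<close>

lemma card_PiE_pair_ge:
  assumes "finite U" "1 \<le> s"
  shows "card {(u, v). u \<in> U \<and> v \<in> U \<and> R u v} * card U ^ (s - 1)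
      \<le> card {z \<in> PiE {..s} (\<lambda>_. U). R (z 0) (z 1)}"
proof -
  let ?P = "{(u, v). u \<in> U \<and> v \<in> U \<and> R u v}"
  let ?F = "PiE {2..s} (\<lambda>_. U)"
  let ?f = "\<lambda>((u, v), g). g(0 := u, 1 := v) :: nat \<Rightarrow> _"
  have "card (?P \<times> ?F) \<le> card {z \<in> PiE {..s} (\<lambda>_. U). R (z 0) (z 1)}"
  proof (rule card_inj_on_le[where f = ?f])
    show "inj_on ?f (?P \<times> ?F)"
    proof (rule inj_onI)
      fix a b assume a: "a \<in> ?P \<times> ?F" "b \<in> ?P \<times> ?F" and eq: "?f a = ?f b"
      obtain u v g where 1: "a = ((u, v), g)" by (metis surj_pair)
      obtain u' v' g' where 2: "b = ((u', v'), g')" by (metis surj_pair)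
      have eq: "(g(0 := u, 1 := v)) i = (g'(0 := u', 1 := v')) i" for i
        using eq 1 2 by simp
      have "u = u'" "v = v'"
        using eq[of 0] eq[of 1] by auto
      moreover have "g i = g' i" if "i \<in> {2..s}" for i
        using eq[of i] that by auto
      then have "g = g'"
        using a 1 2 by (intro PiE_ext[of g "{2..s}" "\<lambda>_. U" g']) auto
      ultimately show "a = b" using 1 2 by simp
    qed
    show "?f ` (?P \<times> ?F) \<subseteq> {z \<in> PiE {..s} (\<lambda>_. U). R (z 0) (z 1)}"
    proof clarsimp
      fix u v g assume g: "g \<in> ?F" "u \<in> U" "v \<in> U"
      show "g(0 := u, Suc 0 := v) \<in> PiE {..s} (\<lambda>_. U)"
      proof (rule PiE_I)
        fix i assume "i \<in> {..s}"
        then show "(g(0 := u, Suc 0 := v)) i \<in> U"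
          using g by (cases "i = 0 \<or> i = 1") (auto simp: PiE_def Pi_def)
      next
        fix i assume "i \<notin> {..s}"
        then show "(g(0 := u, Suc 0 := v)) i = undefined"
          using g assms(2) by (auto simp: PiE_def extensional_def)
      qed
    qed
    show "finite {z \<in> PiE {..s} (\<lambda>_. U). R (z 0) (z 1)}"
      using assms(1) by (simp add: finite_PiE)
  qed
  then show ?thesis
    by (simp add: card_cartesian_product card_PiE)
qed

section \<open>Light pairs\<close>

definition has_subdivision :: "'a set \<Rightarrow> 'a set \<Rightarrow> ('a \<Rightarrow> 'a \<Rightarrow> bool) \<Rightarrow> 'b graph \<Rightarrow> bool" where
  "has_subdivision A B E H \<longleftrightarrow>
     (\<exists>g h. inj_on g (verts H) \<and> g ` verts H \<subseteq> A \<and> inj_on h (edges H) \<and> h ` edges H \<subseteq> B \<and>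
        (\<forall>e\<in>edges H. \<forall>v\<in>e. E (g v) (h e)))"

text \<open>Disjointness of \<open>A\<close> and \<open>B\<close> keeps the images of old and middle
  vertices apart.\<close>

lemma contains_copy_subdivision:
  assumes "has_subdivision A B E H" "A \<inter> B = {}" "A \<union> B \<subseteq> verts G"
    and "\<And>a b. a \<in> A \<Longrightarrow> b \<in> B \<Longrightarrow> E a b \<Longrightarrow> {a, b} \<in> edges G"
    and "\<And>e. e \<in> edges H \<Longrightarrow> e \<subseteq> verts H"
  shows "contains_copy G (subdivision H)"
proof -
  obtain g h where gh: "inj_on g (verts H)" "g ` verts H \<subseteq> A" "inj_on h (edges H)"
    "h ` edges H \<subseteq> B" "\<forall>e\<in>edges H. \<forall>v\<in>e. E (g v) (h e)"
    using assms(1) unfolding has_subdivision_def by (elim exE conjE) (rule that)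
  let ?f = "case_sum g h"
  have "inj_on ?f (Inl ` verts H \<union> Inr ` edges H)"
  proof (rule inj_onI)
    fix x y assume xy: "x \<in> Inl ` verts H \<union> Inr ` edges H" "y \<in> Inl ` verts H \<union> Inr ` edges H"
      "?f x = ?f y"
    have "g u \<noteq> h e" if "u \<in> verts H" "e \<in> edges H" for u e
      using gh(2,4) assms(2) that by (metis disjoint_iff image_subset_iff)
    then show "x = y"
      using xy gh(1,3) by (cases x; cases y) (auto simp: inj_on_def, metis)
  qed
  moreover have "?f ` (Inl ` verts H \<union> Inr ` edges H) \<subseteq> verts G"
    using gh(2,4) assms(3) by (simp add: image_Un image_image) blast
  moreover have "?f ` {Inl v, Inr e} \<in> edges G" if "e \<in> edges H" "v \<in> e" for v e
  proof -
    have "g v \<in> A" "h e \<in> B" "E (g v) (h e)"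
      using gh(2,4,5) assms(5)[OF that(1)] that by blast+
    then show ?thesis using assms(4) by simp
  qed
  ultimately show ?thesis
    unfolding contains_copy_def subdivision_def by (intro exI[of _ ?f]) auto
qed

text \<open>If no vertex of \<open>B\<close> can serve two edges, then any choice of middle vertices
  is automatically injective.\<close>

lemma has_subdivisionI:
  assumes "inj_on g (verts H)" "g ` verts H \<subseteq> A"
    and "\<And>e. e \<in> edges H \<Longrightarrow> \<exists>b\<in>B. \<forall>v\<in>e. E (g v) b"
    and "\<And>e e' b. e \<in> edges H \<Longrightarrow> e' \<in> edges H \<Longrightarrow> b \<in> B \<Longrightarrow> \<forall>v\<in>e \<union> e'. E (g v) b \<Longrightarrow> e = e'"
  shows "has_subdivision A B E H"
proof -
  obtain h where h: "\<forall>e\<in>edges H. h e \<in> B \<and> (\<forall>v\<in>e. E (g v) (h e))"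
    using assms(3) by metis
  moreover have "inj_on h (edges H)"
    using h assms(4) by (metis Un_iff inj_onI)
  ultimately show ?thesis
    unfolding has_subdivision_def using assms(1,2) by blast
qed

locale subdivision_free =
  fixes A B :: "'a set" and E :: "'a \<Rightarrow> 'a \<Rightarrow> bool" and H :: "'b graph"
  assumes finite_A: "finite A" and finite_B: "finite B"
    and simple_H: "simple_graph H"
    and no_subdivision: "\<not> has_subdivision A B E H"
begin

definition mids :: "'a \<Rightarrow> 'a \<Rightarrow> 'a set" where
  "mids u v = {b \<in> B. E u b \<and> E v b}"

definition nbr :: "'a \<Rightarrow> 'a set" where
  "nbr b = {a \<in> A. E a b}"

text \<open>Pairs with at least \<open>card (edges H)\<close> common neighbours are excluded, because a clique of such
  pairs on \<open>card (verts H)\<close> vertices yields the subdivision greedily.\<close>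

definition light :: "'a \<Rightarrow> 'a \<Rightarrow> bool" where
  "light u v \<longleftrightarrow> u \<noteq> v \<and> mids u v \<noteq> {} \<and> card (mids u v) < card (edges H)"

definition light_pairs :: "'a set \<Rightarrow> ('a \<times> 'a) set" where
  "light_pairs U = {(u, v). u \<in> U \<and> v \<in> U \<and> light u v}"

definition light_nbr :: "'a \<Rightarrow> 'a set" where
  "light_nbr v = {u \<in> A. light v u}"

lemma mids_commute: "mids u v = mids v u"
  by (auto simp: mids_def)

lemma light_commute: "light u v \<longleftrightarrow> light v u"
  by (auto simp: light_def mids_commute[of u v])

lemma finite_mids: "finite (mids u v)"
  using finite_B by (simp add: mids_def)

lemma finite_nbr: "finite (nbr b)"
  using finite_A by (simp add: nbr_def)

lemma finite_light_nbr: "finite (light_nbr b)"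
  using finite_A by (simp add: light_nbr_def)

lemma finite_light_pairs: "finite U \<Longrightarrow> finite (light_pairs U)"
  by (rule finite_subset[of _ "U \<times> U"]) (auto simp: light_pairs_def)

lemma finite_edges_H: "finite (edges H)"
proof (rule finite_subset)
  show "edges H \<subseteq> Pow (verts H)"
    using simple_H by (auto simp: simple_graph_def)
  show "finite (Pow (verts H))"
    using simple_H by (simp add: simple_graph_def)
qed

lemma no_heavy_clique:
  assumes "Q \<subseteq> A" "card Q = card (verts H)"
  shows "\<exists>u\<in>Q. \<exists>v\<in>Q. u \<noteq> v \<and> card (mids u v) < card (edges H)"
proof (rule ccontr)
  assume "\<not> ?thesis"
  then have heavy: "card (edges H) \<le> card (mids u v)" if "u \<in> Q" "v \<in> Q" "u \<noteq> v" for u v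
    using that by force
  have "finite Q" using assms(1) finite_A finite_subset by blast
  moreover have "finite (verts H)" using simple_H by (simp add: simple_graph_def)
  ultimately obtain g where g: "bij_betw g (verts H) Q"
    using assms(2) by (metis finite_same_card_bij)
  \<comment> \<open>The candidates for the middle vertex of \<open>e\<close>; for an edge of
    \<open>H\<close> they are the common neighbours of a heavy pair.\<close>
  let ?F = "\<lambda>e. {b \<in> B. \<forall>v\<in>e. E (g v) b}"
  have "card (edges H) \<le> card (?F e)" if "e \<in> edges H" for e
  proof -
    have "card e = 2" "e \<subseteq> verts H" using simple_H that by (auto simp: simple_graph_def)
    then obtain x y where xy: "e = {x, y}" "x \<noteq> y" "x \<in> verts H" "y \<in> verts H"
      by (auto simp: card_2_iff)
    then have "g x \<noteq> g y" "g x \<in> Q" "g y \<in> Q"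
      using g by (auto simp: bij_betw_def inj_on_def)
    moreover have "?F e = mids (g x) (g y)"
      using xy by (auto simp: mids_def)
    ultimately show ?thesis using heavy by simp
  qed
  then obtain h where "inj_on h (edges H)" "\<forall>e\<in>edges H. h e \<in> ?F e"
    using distinct_representatives[OF finite_edges_H, of ?F] by blast
  then have "has_subdivision A B E H"
    unfolding has_subdivision_def using g assms(1)
    by (intro exI[of _ g] exI[of _ h]) (auto simp: bij_betw_def)
  then show False using no_subdivision by simp
qed

section \<open>Lower bounds on the number of light pairs\<close>

text \<open>Any two vertices of \<open>nbr b\<close> share the neighbour \<open>b\<close>, so
  distinct ones form a light or a heavy pair. Heavy cliques are excluded by
  \<open>no_heavy_clique\<close>, hence the weak Turan bound applies; its diagonal pairs give the
  summand \<open>card Y\<close>.\<close>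

lemma card_light_pairs_nbr:
  assumes "b \<in> B" "Y \<subseteq> nbr b"
  shows "(card Y)\<^sup>2 \<le> 4 ^ card (verts H) * (card (light_pairs Y) + card Y)"
proof -
  have Y: "finite Y" "Y \<subseteq> A"
    using assms(2) finite_nbr[of b] finite_subset by (auto simp: nbr_def)
  let ?R = "\<lambda>u v. card (edges H) \<le> card (mids u v)"
  let ?P = "{(u, v). u \<in> Y \<and> v \<in> Y \<and> (u = v \<or> \<not> ?R u v)}"
  have "(card Y)\<^sup>2 \<le> 4 ^ card (verts H) * card ?P"
  proof (rule card_nonadjacent_ge[OF Y(1)])
    show "symp ?R"
      by (rule sympI) (simp add: mids_commute)
    show "\<exists>u\<in>Q. \<exists>v\<in>Q. u \<noteq> v \<and> \<not> ?R u v" if "Q \<subseteq> Y" "card Q = card (verts H)" for Q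
      using no_heavy_clique[of Q] that Y(2) by (auto simp: not_le)
  qed
  also have "card ?P \<le> card (light_pairs Y \<union> (\<lambda>u. (u, u)) ` Y)"
  proof (rule card_mono)
    have "mids u v \<noteq> {}" if "u \<in> Y" "v \<in> Y" for u v
      using assms that by (auto simp: mids_def nbr_def)
    then show "?P \<subseteq> light_pairs Y \<union> (\<lambda>u. (u, u)) ` Y"
      by (auto simp: light_pairs_def light_def)
  qed (use Y finite_light_pairs in auto)
  also have "\<dots> \<le> card (light_pairs Y) + card Y"
    using card_Un_le[of "light_pairs Y" "(\<lambda>u. (u, u)) ` Y"] card_image_le[OF Y(1), of "\<lambda>u. (u, u)"]
    by linarith
  finally show ?thesis by simp
qed

text \<open>Sum the bound for a single neighbourhood over \<open>B\<close>: a light pair is counted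
  once per common neighbour, so fewer than \<open>card (edges H)\<close> times. Cauchy-Schwarz
  brings in \<open>Y\<close>, the number of edges between \<open>U\<close> and
  \<open>B\<close>.\<close>

lemma card_light_pairs_ge:
  assumes "U \<subseteq> A"
  defines "Y \<equiv> \<Sum>u\<in>U. card {b \<in> B. E u b}"
  shows "Y\<^sup>2 \<le> card B * (4 ^ card (verts H) * (card (edges H) * card (light_pairs U) + Y))"
proof -
  have U: "finite U" using assms(1) finite_A finite_subset by blast
  have int: "U \<inter> nbr b = {u \<in> U. E u b}" for b
    using assms(1) by (auto simp: nbr_def)
  have Y: "Y = (\<Sum>b\<in>B. card (U \<inter> nbr b))"
    unfolding Y_def int by (rule sum_card_swap[OF U finite_B])
  have "(\<Sum>b\<in>B. card (light_pairs (U \<inter> nbr b)))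
      = (\<Sum>b\<in>B. card {x \<in> light_pairs U. E (fst x) b \<and> E (snd x) b})"
    using assms(1) by (intro sum.cong refl arg_cong[of _ _ card]) (auto simp: light_pairs_def nbr_def)
  also have "\<dots> = (\<Sum>x\<in>light_pairs U. card {b \<in> B. E (fst x) b \<and> E (snd x) b})"
    by (rule sum_card_swap[OF finite_B finite_light_pairs[OF U]])
  also have "\<dots> \<le> (\<Sum>x\<in>light_pairs U. card (edges H))"
    by (intro sum_mono) (auto simp: light_pairs_def light_def mids_def)
  finally have L: "(\<Sum>b\<in>B. card (light_pairs (U \<inter> nbr b))) \<le> card (edges H) * card (light_pairs U)"
    by (simp add: mult.commute)
  have "Y\<^sup>2 \<le> card B * (\<Sum>b\<in>B. (card (U \<inter> nbr b))\<^sup>2)"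
    unfolding Y by (rule sum_squared_le[OF finite_B])
  also have "\<dots> \<le> card B * (\<Sum>b\<in>B. 4 ^ card (verts H) * (card (light_pairs (U \<inter> nbr b)) + card (U \<inter> nbr b)))"
    by (intro mult_left_mono sum_mono card_light_pairs_nbr) auto
  also have "\<dots> = card B * (4 ^ card (verts H) * ((\<Sum>b\<in>B. card (light_pairs (U \<inter> nbr b))) + Y))"
    unfolding Y by (simp add: sum_distrib_left[symmetric] sum.distrib)
  also have "\<dots> \<le> card B * (4 ^ card (verts H) * (card (edges H) * card (light_pairs U) + Y))"
    by (intro mult_left_mono add_right_mono L) auto
  finally show ?thesis .
qed

text \<open>Once \<open>Y\<close> reaches \<open>2 * card B * 4 ^ card (verts H)\<close>, the
  diagonal term is at most half of the square and can be absorbed, whence the factor 2 in the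
  denominator.\<close>

lemma card_light_pairs_ge_of_sum:
  fixes Y :: real
  assumes "U \<subseteq> A" "0 < card B" "0 < card (edges H)"
    and "2 * card B * 4 ^ card (verts H) \<le> Y" "Y \<le> (\<Sum>u\<in>U. real (card {b \<in> B. E u b}))"
  shows "Y\<^sup>2 / (2 * card B * 4 ^ card (verts H) * card (edges H)) \<le> card (light_pairs U)"
proof -
  define y where "y = (\<Sum>u\<in>U. real (card {b \<in> B. E u b}))"
  define K where "K = real (4 ^ card (verts H))"
  define \<beta> where "\<beta> = real (card B)"
  define L where "L = real (card (edges H))"
  define P where "P = real (card (light_pairs U))"
  have pos: "K > 0" "\<beta> > 0" "L > 0" "0 \<le> Y"
    using assms(2,3,4) by (auto simp: K_def \<beta>_def L_def intro: order.trans[rotated])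
  have "real ((\<Sum>u\<in>U. card {b \<in> B. E u b})\<^sup>2) \<le> real (card B * (4 ^ card (verts H) *
      (card (edges H) * card (light_pairs U) + (\<Sum>u\<in>U. card {b \<in> B. E u b}))))"
    using card_light_pairs_ge[OF assms(1)] by (simp only: of_nat_le_iff)
  then have 1: "y\<^sup>2 \<le> \<beta> * (K * (L * P + y))"
    by (simp add: y_def K_def \<beta>_def L_def P_def)
  have 2: "2 * \<beta> * K \<le> Y" "Y \<le> y"
    using assms(4,5) by (auto simp: y_def K_def \<beta>_def)
  have "2 * \<beta> * K * y \<le> y * y"
    using 2 pos by (intro mult_right_mono) auto
  then have "y\<^sup>2 \<le> 2 * \<beta> * K * L * P"
    using 1 by (simp add: power2_eq_square algebra_simps)
  moreover have "Y\<^sup>2 \<le> y\<^sup>2"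
    using 2 pos by (intro power_mono) auto
  ultimately have "Y\<^sup>2 \<le> P * (2 * \<beta> * K * L)"
    by (simp add: mult_ac)
  then have "Y\<^sup>2 / (2 * \<beta> * K * L) \<le> P"
    using pos by (simp add: divide_le_eq)
  then show ?thesis by (simp add: P_def \<beta>_def K_def L_def)
qed

text \<open>Subtracting \<open>\<delta> * card U\<close> removes any size condition on
  \<open>U\<close>, since for small \<open>U\<close> the left side is at most 0. The bound can thus
  be summed over all common neighbourhoods, whatever their sizes.\<close>

lemma card_light_pairs_ge_min_degree:
  fixes \<delta> :: real
  assumes "U \<subseteq> A" "0 < card B" "0 < card (edges H)" "0 \<le> \<delta>"
    and "\<And>a. a \<in> A \<Longrightarrow> \<delta> \<le> card {b \<in> B. E a b}"
  shows "\<delta>\<^sup>2 / (2 * card B * 4 ^ card (verts H) * card (edges H)) * (card U)\<^sup>2 - \<delta> * card U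
      \<le> card (light_pairs U)"
proof (cases "2 * card B * 4 ^ card (verts H) \<le> \<delta> * card U")
  case True
  have "(\<Sum>u\<in>U. \<delta>) \<le> (\<Sum>u\<in>U. real (card {b \<in> B. E u b}))"
    using assms by (intro sum_mono) auto
  then have "(\<delta> * card U)\<^sup>2 / (2 * card B * 4 ^ card (verts H) * card (edges H)) \<le> card (light_pairs U)"
    using assms(1-3) True by (intro card_light_pairs_ge_of_sum) (auto simp: mult.commute)
  moreover have "0 \<le> \<delta> * card U" using assms(4) by simp
  ultimately show ?thesis by (simp add: power_mult_distrib)
next
  case False
  define Q where "Q = real (2 * card B * 4 ^ card (verts H))"
  have Q: "0 < Q" "\<delta> * card U \<le> Q" using False assms(2) by (auto simp: Q_def)
  have L: "1 \<le> real (card (edges H))" using assms(3) by linarith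
  have "\<delta>\<^sup>2 / (Q * card (edges H)) * (card U)\<^sup>2 = (\<delta> * card U) * ((\<delta> * card U) / (Q * card (edges H)))"
    by (simp add: power2_eq_square)
  also have "\<dots> \<le> (\<delta> * card U) * 1"
  proof (rule mult_left_mono)
    have "\<delta> * card U \<le> Q * card (edges H)"
      using mult_left_mono[of 1 "real (card (edges H))" Q] L Q by linarith
    then show "\<delta> * card U / (Q * card (edges H)) \<le> 1"
      using Q L by (auto simp: divide_le_eq)
  qed (use assms(4) in simp)
  finally show ?thesis unfolding Q_def by simp
qed

end

section \<open>Tuples and their common light neighbours\<close>

locale K_plus_free = subdivision_free A B E "K_plus s t"
  for A B :: "'a set" and E :: "'a \<Rightarrow> 'a \<Rightarrow> bool" and s t :: nat +
  assumes s_pos: "0 < s" and t_pos: "0 < t"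
begin

text \<open>A tuple \<open>z\<close> is a candidate for the images of \<open>RV, SV 0, \<dots>, SV (s - 1)\<close>, in this order.\<close>

definition tuples :: "(nat \<Rightarrow> 'a) set" where
  "tuples = {z \<in> PiE {..s} (\<lambda>_. A). light (z 0) (z 1)}"

text \<open>Candidates for the images of the vertices \<open>TV j\<close>.\<close>

definition centres :: "(nat \<Rightarrow> 'a) \<Rightarrow> 'a set" where
  "centres z = {v \<in> A. \<forall>i\<le>s. light v (z i)}"

text \<open>No middle vertex can serve two edges that leave the same candidate
  \<open>v\<close>.\<close>

definition good :: "(nat \<Rightarrow> 'a) \<Rightarrow> 'a \<Rightarrow> bool" where
  "good z v \<longleftrightarrow> (\<forall>i\<le>s. \<forall>j\<le>s. i \<noteq> j \<longrightarrow> mids v (z i) \<inter> mids v (z j) = {})"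

text \<open>Concerns clashes between different candidates only; those at a single one are left to
  \<open>good\<close>.\<close>

definition conflict_free :: "(nat \<Rightarrow> 'a) \<Rightarrow> 'a set \<Rightarrow> bool" where
  "conflict_free z W \<longleftrightarrow>
     (\<forall>v\<in>W. \<forall>w\<in>W. v \<noteq> w \<longrightarrow> (\<forall>i\<le>s. \<forall>j\<le>s. mids v (z i) \<inter> mids w (z j) = {}))"

text \<open>Such pairs arise when many good centres are adjacent to one clashing middle vertex
  \<open>m\<close>. For a given pair they confine an entry of the tuple to few places.\<close>

definition close_pairs :: "(nat \<Rightarrow> 'a) \<Rightarrow> ('a \<times> 'a) set" where
  "close_pairs z = {(v, w). v \<in> centres z \<and> w \<in> centres z \<and> light v w \<and>
     (\<exists>l\<le>s. \<exists>m\<in>mids v w. E (z l) m)}"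

lemma finite_tuples: "finite tuples"
  unfolding tuples_def using finite_A by (simp add: finite_PiE)

lemma finite_centres: "finite (centres z)"
  unfolding centres_def using finite_A by simp

lemma conflict_free_subset: "conflict_free z W \<Longrightarrow> V \<subseteq> W \<Longrightarrow> conflict_free z V"
  unfolding conflict_free_def by blast

lemma tuples_in_A: "z \<in> tuples \<Longrightarrow> i \<le> s \<Longrightarrow> z i \<in> A"
  by (auto simp: tuples_def)

text \<open>No vertex of \<open>B\<close> can serve two edges between \<open>W\<close> and the
  tuple: \<open>good\<close> excludes this at one centre, \<open>conflict_free\<close> at two. A
  vertex serving \<open>{RV, SV 0}\<close> and another edge would lie in \<open>mids\<close> of one
  centre with both \<open>z 0\<close> and \<open>z 1\<close>, again against \<open>good\<close>. So
  \<open>has_subdivisionI\<close> applies.\<close>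

lemma has_subdivision_of_conflict_free:
  assumes z: "z \<in> tuples" and W: "W \<subseteq> centres z" "\<And>v. v \<in> W \<Longrightarrow> good z v"
    and cf: "conflict_free z W" and card: "card W = t"
  shows "has_subdivision A B E (K_plus s t)"
proof -
  have "finite W" using W(1) finite_centres finite_subset by blast
  then obtain w where w: "bij_betw w {..<t} W"
    using card by (metis card_lessThan finite_lessThan finite_same_card_bij)
  \<comment> \<open>Numbering \<open>RV, SV 0, SV 1, ...\<close> like the tuple gives all edges the
    form \<open>{x i, TV j}\<close>, except for \<open>{x 0, x 1}\<close>.\<close>
  define x where "x i = (case i of 0 \<Rightarrow> RV | Suc i \<Rightarrow> SV i)" for i
  define g where "g v = (case v of RV \<Rightarrow> z 0 | SV i \<Rightarrow> z (Suc i) | TV j \<Rightarrow> w j)" for v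
  have g_x: "g (x i) = z i" for i by (simp add: g_def x_def split: nat.split)
  have g_TV: "g (TV j) = w j" for j by (simp add: g_def)
  have x_inj: "x i = x j \<Longrightarrow> i = j" for i j by (auto simp: x_def split: nat.splits)
  have x_TV: "x i \<noteq> TV j" for i j by (auto simp: x_def split: nat.splits)
  have verts: "verts (K_plus s t) = x ` {..s} \<union> TV ` {..<t}"
  proof -
    have "x ` {..s} = insert RV (SV ` {..<s})"
      by (auto simp: x_def atMost_Suc_eq_insert_0 lessThan_Suc_atMost[symmetric] lessThan_Suc_eq_insert_0 image_image)
    then show ?thesis by (auto simp: K_plus_def)
  qed
  have edges_cases: "(\<exists>i j. i \<le> s \<and> j < t \<and> e = {x i, TV j}) \<or> e = {x 0, x 1}"
    if e: "e \<in> edges (K_plus s t)" for e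
  proof -
    consider i j where "i < s" "j < t" "e = {SV i, TV j}" | "e = {RV, SV 0}" | j where "j < t" "e = {RV, TV j}"
      using e by (auto simp: K_plus_def)
    then show ?thesis
    proof cases
      case 1
      then show ?thesis by (intro disjI1 exI[of _ "Suc i"] exI[of _ j]) (simp add: x_def)
    next
      case 2
      then show ?thesis by (simp add: x_def)
    next
      case 3
      then show ?thesis by (intro disjI1 exI[of _ 0] exI[of _ j]) (simp add: x_def)
    qed
  qed
  have w_in: "w j \<in> W" if "j < t" for j using w that by (auto simp: bij_betw_def)
  have w_inj: "j = k" if "j < t" "k < t" "w j = w k" for j k
    using w that by (auto simp: bij_betw_def inj_on_def)
  have light_w: "light (w j) (z i)" if "j < t" "i \<le> s" for i j
    using w_in[OF that(1)] W(1) that(2) by (auto simp: centres_def)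
  have light_01: "light (z 0) (z 1)" using z by (simp add: tuples_def)
  have same: "i = k \<and> j = l" if "j < t" "l < t" "i \<le> s" "k \<le> s"
    "b \<in> mids (w j) (z i)" "b \<in> mids (w l) (z k)" for i j k l b
  proof (cases "j = l")
    case True
    then show ?thesis using W(2)[OF w_in[OF that(1)]] that by (auto simp: good_def)
  next
    case False
    then show ?thesis
      using cf w_in[OF that(1)] w_in[OF that(2)] w_inj[OF that(1,2)] that
      unfolding conflict_free_def by blast
  qed
  have no_01: False if "j < t" "b \<in> B" "E (z 0) b" "E (z 1) b" "E (w j) b" for j b
    using same[of j j 0 1 b] that s_pos by (auto simp: mids_def)
  \<comment> \<open>Membership in \<open>tuples\<close> does not make \<open>z\<close> injective.
    Equal entries would share the nonempty set of middle vertices towards \<open>w 0\<close>,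
    against \<open>good\<close>.\<close>
  have z_inj: "i = k" if ik: "i \<le> s" "k \<le> s" "z i = z k" for i k
  proof -
    obtain b where "b \<in> mids (w 0) (z i)"
      using light_w[OF t_pos ik(1)] by (auto simp: light_def)
    then show ?thesis using same[of 0 0 i k b] ik t_pos by auto
  qed
  show ?thesis
  proof (rule has_subdivisionI[where g = g])
    show "inj_on g (verts (K_plus s t))"
      unfolding verts
    proof (rule inj_onI)
      have ne: "z i \<noteq> w j" if "i \<le> s" "j < t" for i j
        using light_w[OF that(2,1)] by (auto simp: light_def)
      fix a b assume "a \<in> x ` {..s} \<union> TV ` {..<t}" "b \<in> x ` {..s} \<union> TV ` {..<t}" "g a = g b"
      then show "a = b"
        using ne ne[symmetric] by (auto simp: g_x g_TV dest: z_inj w_inj)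
    qed
    show "g ` verts (K_plus s t) \<subseteq> A"
    proof -
      have "W \<subseteq> A" using W(1) by (auto simp: centres_def)
      then show ?thesis
        unfolding verts using tuples_in_A[OF z] w_in by (auto simp: g_x g_TV)
    qed
    show "\<exists>b\<in>B. \<forall>v\<in>e. E (g v) b" if "e \<in> edges (K_plus s t)" for e
      using edges_cases[OF that]
    proof (elim disjE exE conjE)
      fix i j assume "i \<le> s" "j < t" "e = {x i, TV j}"
      then show ?thesis
        using light_w[of j i] by (auto simp: light_def mids_def g_x g_TV)
    next
      assume "e = {x 0, x 1}"
      then show ?thesis
        using light_01 by (auto simp: light_def mids_def g_x simp del: One_nat_def)
    qed
    show "e = e'" if e: "e \<in> edges (K_plus s t)" "e' \<in> edges (K_plus s t)"
      and b: "b \<in> B" "\<forall>v\<in>e \<union> e'. E (g v) b" for e e' b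
      using edges_cases[OF e(1)]
    proof (elim disjE exE conjE)
      fix i j assume ij: "i \<le> s" "j < t" "e = {x i, TV j}"
      show ?thesis
        using edges_cases[OF e(2)]
      proof (elim disjE exE conjE)
        fix k l assume "k \<le> s" "l < t" "e' = {x k, TV l}"
        then show ?thesis
          using ij b same[of j l i k b] by (auto simp: mids_def g_x g_TV)
      next
        assume "e' = {x 0, x 1}"
        then show ?thesis
          using ij b no_01[of j b] by (auto simp: g_x g_TV simp del: One_nat_def)
      qed
    next
      assume e01: "e = {x 0, x 1}"
      show ?thesis
        using edges_cases[OF e(2)]
      proof (elim disjE exE conjE)
        fix k l assume "k \<le> s" "l < t" "e' = {x k, TV l}"
        then show ?thesis
          using e01 b no_01[of l b] by (auto simp: g_x g_TV simp del: One_nat_def)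
      next
        assume "e' = {x 0, x 1}"
        then show ?thesis using e01 by simp
      qed
    qed
  qed
qed

text \<open>A largest conflict-free set \<open>W\<close> of good centres has fewer than
  \<open>t\<close> members, so at most \<open>q\<close> middle vertices join it to the tuple, and by
  maximality every good centre is adjacent to one of them. The good centres adjacent to one such
  \<open>m\<close> span many light pairs, all of them close because \<open>m\<close> is a common
  neighbour that is also adjacent to an entry of the tuple.\<close>

lemma card_good_le:
  assumes z: "z \<in> tuples"
  defines "q \<equiv> t * (Suc s * card (edges (K_plus s t)))"
  shows "(card {v \<in> centres z. good z v})\<^sup>2
      \<le> q\<^sup>2 * 4 ^ card (verts (K_plus s t)) * (card (close_pairs z) + card (centres z))"
proof -
  let ?G = "{v \<in> centres z. good z v}"
  let ?ok = "\<lambda>W. W \<subseteq> ?G \<and> conflict_free z W"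
  have finG: "finite ?G" using finite_centres by simp
  have "?ok {}" by (simp add: conflict_free_def)
  moreover have "\<forall>W. ?ok W \<longrightarrow> card W < Suc (card ?G)"
    using finG by (auto simp: less_Suc_eq_le intro: card_mono)
  ultimately obtain W where W: "?ok W" and max: "\<And>V. ?ok V \<Longrightarrow> card V \<le> card W"
    using ex_has_greatest_nat[of ?ok "{}" card "Suc (card ?G)"] by blast
  have finW: "finite W" using W finG finite_subset by blast
  have "card W < t"
  proof (rule ccontr)
    assume "\<not> card W < t"
    then obtain V where V: "V \<subseteq> W" "card V = t"
      by (metis not_less obtain_subset_with_card_n)
    then have "has_subdivision A B E (K_plus s t)"
      using W conflict_free_subset[of z W V]
      by (intro has_subdivision_of_conflict_free[OF z, of V]) auto
    then show False using no_subdivision by simp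
  qed
  define Q where "Q = (\<Union>v\<in>W. \<Union>i\<in>{..s}. mids v (z i))"
  have finQ: "finite Q" using finW finite_mids by (auto simp: Q_def)
  have "card Q \<le> (\<Sum>v\<in>W. card (\<Union>i\<in>{..s}. mids v (z i)))"
    unfolding Q_def by (rule card_UN_le[OF finW])
  also have "\<dots> \<le> (\<Sum>v\<in>W. \<Sum>i\<le>s. card (mids v (z i)))"
    by (intro sum_mono card_UN_le) simp
  also have "\<dots> \<le> (\<Sum>v\<in>W. \<Sum>i\<le>s. card (edges (K_plus s t)))"
    using W by (intro sum_mono less_imp_le) (auto simp: centres_def light_def)
  also have "\<dots> = card W * (Suc s * card (edges (K_plus s t)))"
    by simp
  also have "\<dots> \<le> q"
    unfolding q_def using \<open>card W < t\<close> by (intro mult_right_mono) auto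
  finally have cardQ: "card Q \<le> q" .
  have cover: "\<exists>m\<in>Q. v \<in> nbr m" if v: "v \<in> ?G" for v
  proof (cases "v \<in> W")
    case True
    have "mids v (z 0) \<noteq> {}" using v by (auto simp: centres_def light_def)
    then show ?thesis using True v by (force simp: Q_def nbr_def mids_def centres_def)
  next
    case False
    then have "card (insert v W) > card W" using finW by simp
    then have "\<not> conflict_free z (insert v W)"
      using max[of "insert v W"] v W by auto
    then obtain w i j m where "w \<in> W" "i \<le> s" "j \<le> s" "m \<in> mids v (z i)" "m \<in> mids w (z j)"
      using W unfolding conflict_free_def by blast
    then show ?thesis using v by (intro bexI[of _ m]) (auto simp: Q_def nbr_def mids_def centres_def)
  qed
  have Y: "(card (?G \<inter> nbr m))\<^sup>2
      \<le> 4 ^ card (verts (K_plus s t)) * (card (close_pairs z) + card (centres z))" if m: "m \<in> Q" for m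
  proof -
    let ?Y = "?G \<inter> nbr m"
    obtain v i where vi: "v \<in> W" "i \<le> s" "m \<in> mids v (z i)"
      using m by (auto simp: Q_def)
    have "(card ?Y)\<^sup>2 \<le> 4 ^ card (verts (K_plus s t)) * (card (light_pairs ?Y) + card ?Y)"
      using vi by (intro card_light_pairs_nbr[of m]) (auto simp: mids_def)
    also have "\<dots> \<le> 4 ^ card (verts (K_plus s t)) * (card (close_pairs z) + card (centres z))"
    proof (intro mult_left_mono add_mono card_mono)
      show "finite (close_pairs z)"
        by (rule finite_subset[of _ "centres z \<times> centres z"])
           (auto simp: close_pairs_def finite_centres)
      show "light_pairs ?Y \<subseteq> close_pairs z"
        using vi by (auto simp: light_pairs_def close_pairs_def mids_def nbr_def)
    qed (auto simp: finite_centres)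
    finally show ?thesis .
  qed
  have "card ?G \<le> card (\<Union>m\<in>Q. ?G \<inter> nbr m)"
    using cover finQ finG by (intro card_mono) auto
  also have "\<dots> \<le> (\<Sum>m\<in>Q. card (?G \<inter> nbr m))"
    by (rule card_UN_le[OF finQ])
  finally have "(card ?G)\<^sup>2 \<le> (\<Sum>m\<in>Q. card (?G \<inter> nbr m))\<^sup>2"
    by (intro power_mono) auto
  also have "\<dots> \<le> card Q * (\<Sum>m\<in>Q. (card (?G \<inter> nbr m))\<^sup>2)"
    by (rule sum_squared_le[OF finQ])
  also have "\<dots> \<le> card Q * (\<Sum>m\<in>Q. 4 ^ card (verts (K_plus s t)) * (card (close_pairs z) + card (centres z)))"
    by (intro mult_left_mono sum_mono Y) auto
  also have "\<dots> = (card Q)\<^sup>2 * 4 ^ card (verts (K_plus s t)) * (card (close_pairs z) + card (centres z))"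
    by (simp add: power2_eq_square)
  also have "\<dots> \<le> q\<^sup>2 * 4 ^ card (verts (K_plus s t)) * (card (close_pairs z) + card (centres z))"
    using cardQ by (intro mult_right_mono power_mono) auto
  finally show ?thesis .
qed

section \<open>Double counting tuples against pairs of centres\<close>

definition common :: "'a \<times> 'a \<Rightarrow> 'a set" where
  "common x = light_nbr (fst x) \<inter> light_nbr (snd x)"

text \<open>The places left for a tuple entry that is adjacent to a middle vertex of
  \<open>u\<close> and \<open>v\<close>.\<close>

definition near :: "'a \<Rightarrow> 'a \<Rightarrow> 'a set" where
  "near u v = (\<Union>m\<in>mids u v. nbr m)"

lemma finite_common: "finite (common x)"
  by (simp add: common_def finite_light_nbr)

lemma card_near_le:
  assumes "light u v" "\<And>b. b \<in> B \<Longrightarrow> card (nbr b) \<le> \<Delta>"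
  shows "finite (near u v) \<and> card (near u v) \<le> card (edges (K_plus s t)) * \<Delta>"
proof
  show "finite (near u v)" by (simp add: near_def finite_mids finite_nbr)
  have "card (near u v) \<le> (\<Sum>m\<in>mids u v. card (nbr m))"
    unfolding near_def by (rule card_UN_le[OF finite_mids])
  also have "\<dots> \<le> (\<Sum>m\<in>mids u v. \<Delta>)"
    using assms(2) by (intro sum_mono) (auto simp: mids_def)
  also have "\<dots> \<le> card (edges (K_plus s t)) * \<Delta>"
    using assms(1) by (auto simp: light_def intro!: mult_right_mono)
  finally show "card (near u v) \<le> card (edges (K_plus s t)) * \<Delta>" .
qed

text \<open>The duality that turns sums over tuples into sums over vertices: the functions with
  centre \<open>v\<close> form a full power of \<open>light_nbr v\<close>.\<close>

lemma in_centres_iff: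
  assumes "z \<in> PiE {..s} (\<lambda>_. A)" "v \<in> A"
  shows "v \<in> centres z \<longleftrightarrow> z \<in> PiE {..s} (\<lambda>_. light_nbr v)"
  using assms by (auto simp: centres_def light_nbr_def PiE_def Pi_def)

lemma in_centres_both_iff:
  assumes "z \<in> PiE {..s} (\<lambda>_. A)" "x \<in> A \<times> A"
  shows "fst x \<in> centres z \<and> snd x \<in> centres z \<longleftrightarrow> z \<in> PiE {..s} (\<lambda>_. common x)"
  using in_centres_iff[OF assms(1), of "fst x"] in_centres_iff[OF assms(1), of "snd x"] assms(2)
  by (auto simp: common_def PiE_def Pi_def)

lemma PiE_common_subset: "PiE {..s} (\<lambda>_. common x) \<subseteq> PiE {..s} (\<lambda>_. A)"
  by (intro PiE_mono) (auto simp: common_def light_nbr_def)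

lemma card_centres_squared:
  "(card (centres z))\<^sup>2 = card {x \<in> A \<times> A. fst x \<in> centres z \<and> snd x \<in> centres z}"
proof -
  have "{x \<in> A \<times> A. fst x \<in> centres z \<and> snd x \<in> centres z} = centres z \<times> centres z"
    by (auto simp: centres_def)
  then show ?thesis by (simp add: card_cartesian_product power2_eq_square)
qed

lemma sum_card_centres:
  "(\<Sum>z\<in>PiE {..s} (\<lambda>_. A). card (centres z)) = (\<Sum>v\<in>A. card (light_nbr v) ^ Suc s)"
proof -
  have "(\<Sum>z\<in>PiE {..s} (\<lambda>_. A). card (centres z)) = (\<Sum>z\<in>PiE {..s} (\<lambda>_. A). card {v \<in> A. v \<in> centres z})"
    by (intro sum.cong refl arg_cong[of _ _ card]) (auto simp: centres_def)
  also have "\<dots> = (\<Sum>v\<in>A. card {z \<in> PiE {..s} (\<lambda>_. A). v \<in> centres z})"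
    using finite_A by (intro sum_card_swap) (auto simp: finite_PiE)
  also have "\<dots> = (\<Sum>v\<in>A. card (PiE {..s} (\<lambda>_. light_nbr v)))"
  proof (intro sum.cong refl arg_cong[of _ _ card])
    fix v assume "v \<in> A"
    moreover have "PiE {..s} (\<lambda>_. light_nbr v) \<subseteq> PiE {..s} (\<lambda>_. A)"
      by (intro PiE_mono) (auto simp: light_nbr_def)
    ultimately show "{z \<in> PiE {..s} (\<lambda>_. A). v \<in> centres z} = PiE {..s} (\<lambda>_. light_nbr v)"
      using in_centres_iff by blast
  qed
  also have "\<dots> = (\<Sum>v\<in>A. card (light_nbr v) ^ Suc s)"
    by (simp add: card_PiE)
  finally show ?thesis .
qed

lemma sum_card_centres_squared:
  "(\<Sum>z\<in>PiE {..s} (\<lambda>_. A). (card (centres z))\<^sup>2) = (\<Sum>x\<in>A \<times> A. card (common x) ^ Suc s)"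
proof -
  have "(\<Sum>z\<in>PiE {..s} (\<lambda>_. A). (card (centres z))\<^sup>2)
      = (\<Sum>x\<in>A \<times> A. card {z \<in> PiE {..s} (\<lambda>_. A). fst x \<in> centres z \<and> snd x \<in> centres z})"
    unfolding card_centres_squared using finite_A by (intro sum_card_swap) (auto simp: finite_PiE)
  also have "\<dots> = (\<Sum>x\<in>A \<times> A. card (PiE {..s} (\<lambda>_. common x)))"
  proof (intro sum.cong refl arg_cong[of _ _ card])
    fix x assume "x \<in> A \<times> A"
    then show "{z \<in> PiE {..s} (\<lambda>_. A). fst x \<in> centres z \<and> snd x \<in> centres z} = PiE {..s} (\<lambda>_. common x)"
      using in_centres_both_iff PiE_common_subset by blast
  qed
  also have "\<dots> = (\<Sum>x\<in>A \<times> A. card (common x) ^ Suc s)"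
    by (simp add: card_PiE)
  finally show ?thesis .
qed

text \<open>For a pair \<open>x\<close>, the tuples with both members as centres are those inside
  \<open>common x\<close>: a light pair of \<open>common x\<close> supplies \<open>z 0\<close> and
  \<open>z 1\<close>, and the other \<open>s - 1\<close> entries are free.\<close>

lemma sum_tuples_centres_squared_ge:
  "(\<Sum>x\<in>A \<times> A. card (light_pairs (common x)) * card (common x) ^ (s - 1))
     \<le> (\<Sum>z\<in>tuples. (card (centres z))\<^sup>2)"
proof -
  have "(\<Sum>x\<in>A \<times> A. card (light_pairs (common x)) * card (common x) ^ (s - 1))
      \<le> (\<Sum>x\<in>A \<times> A. card {z \<in> PiE {..s} (\<lambda>_. common x). light (z 0) (z 1)})"
    unfolding light_pairs_def using s_pos by (intro sum_mono card_PiE_pair_ge finite_common) auto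
  also have "\<dots> = (\<Sum>x\<in>A \<times> A. card {z \<in> tuples. fst x \<in> centres z \<and> snd x \<in> centres z})"
  proof (intro sum.cong refl arg_cong[of _ _ card])
    fix x assume "x \<in> A \<times> A"
    then show "{z \<in> PiE {..s} (\<lambda>_. common x). light (z 0) (z 1)}
        = {z \<in> tuples. fst x \<in> centres z \<and> snd x \<in> centres z}"
      using in_centres_both_iff PiE_common_subset unfolding tuples_def by blast
  qed
  also have "\<dots> = (\<Sum>z\<in>tuples. (card (centres z))\<^sup>2)"
    unfolding card_centres_squared using finite_A finite_tuples by (intro sum_card_swap) auto
  finally show ?thesis .
qed

text \<open>For a fixed light pair \<open>x\<close>, closeness forces some entry \<open>z l\<close>
  into \<open>near (fst x) (snd x)\<close>, while the other \<open>s\<close> entries range over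
  \<open>common x\<close>; the factor \<open>Suc s\<close> counts the choices of
  \<open>l\<close>.\<close>

lemma sum_close_pairs_le:
  assumes "\<And>b. b \<in> B \<Longrightarrow> card (nbr b) \<le> \<Delta>"
  shows "(\<Sum>z\<in>tuples. card (close_pairs z))
    \<le> Suc s * (card (edges (K_plus s t)) * \<Delta>) * (\<Sum>x\<in>A \<times> A. card (common x) ^ s)"
proof -
  let ?L = "card (edges (K_plus s t)) * \<Delta>"
  have "(\<Sum>z\<in>tuples. card (close_pairs z)) = (\<Sum>z\<in>tuples. card {x \<in> A \<times> A. x \<in> close_pairs z})"
    by (intro sum.cong refl arg_cong[of _ _ card]) (auto simp: close_pairs_def centres_def)
  also have "\<dots> = (\<Sum>x\<in>A \<times> A. card {z \<in> tuples. x \<in> close_pairs z})"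
    using finite_A finite_tuples by (intro sum_card_swap) auto
  also have "\<dots> \<le> (\<Sum>x\<in>A \<times> A. Suc s * ?L * card (common x) ^ s)"
  proof (rule sum_mono)
    fix x assume x: "x \<in> A \<times> A"
    let ?S = "\<lambda>l. {z \<in> PiE {..s} (\<lambda>_. common x). z l \<in> near (fst x) (snd x)}"
    show "card {z \<in> tuples. x \<in> close_pairs z} \<le> Suc s * ?L * card (common x) ^ s"
    proof (cases "light (fst x) (snd x)")
      case True
      have "{z \<in> tuples. x \<in> close_pairs z} \<subseteq> (\<Union>l\<in>{..s}. ?S l)"
      proof
        fix z assume z: "z \<in> {z \<in> tuples. x \<in> close_pairs z}"
        then have "z \<in> PiE {..s} (\<lambda>_. common x)"
          using in_centres_both_iff[of z x] x by (auto simp: tuples_def close_pairs_def)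
        moreover obtain l m where "l \<le> s" "m \<in> mids (fst x) (snd x)" "E (z l) m"
          using z by (auto simp: close_pairs_def)
        moreover have "z l \<in> A" using \<open>l \<le> s\<close> z tuples_in_A by blast
        ultimately show "z \<in> (\<Union>l\<in>{..s}. ?S l)"
          by (auto simp: near_def nbr_def)
      qed
      then have "card {z \<in> tuples. x \<in> close_pairs z} \<le> card (\<Union>l\<in>{..s}. ?S l)"
        by (intro card_mono) (auto simp: finite_PiE finite_common)
      also have "\<dots> \<le> (\<Sum>l\<le>s. card (?S l))"
        by (intro card_UN_le) auto
      also have "\<dots> \<le> (\<Sum>l\<le>s. ?L * card (common x) ^ (card {..s} - 1))"
        by (intro sum_mono card_PiE_determined_le[where X = "\<lambda>_. near (fst x) (snd x)"]
            card_near_le True assms finite_common) auto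
      finally show ?thesis by (simp add: algebra_simps)
    next
      case False
      then have "{z \<in> tuples. x \<in> close_pairs z} = {}"
        by (auto simp: close_pairs_def)
      then show ?thesis by (simp only: card.empty)
    qed
  qed
  finally show ?thesis by (simp add: sum_distrib_left)
qed

text \<open>If \<open>fst x\<close> is not good, some \<open>z j\<close> lies in
  \<open>near (fst x) (z i)\<close> with \<open>i \<noteq> j\<close>. This set varies with the
  tuple, but not with \<open>z j\<close>, so one coordinate is still confined; the two factors
  \<open>Suc s\<close> count the choices of \<open>i\<close> and \<open>j\<close>.\<close>

lemma sum_not_good_le:
  assumes "\<And>b. b \<in> B \<Longrightarrow> card (nbr b) \<le> \<Delta>"
  shows "(\<Sum>z\<in>tuples. card {v \<in> centres z. \<not> good z v} * card (centres z))
    \<le> Suc s * (Suc s * (card (edges (K_plus s t)) * \<Delta>)) * (\<Sum>x\<in>A \<times> A. card (common x) ^ s)"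
proof -
  let ?L = "card (edges (K_plus s t)) * \<Delta>"
  let ?bad = "\<lambda>z x. fst x \<in> centres z \<and> snd x \<in> centres z \<and> \<not> good z (fst x)"
  have "(\<Sum>z\<in>tuples. card {v \<in> centres z. \<not> good z v} * card (centres z))
      = (\<Sum>z\<in>tuples. card {x \<in> A \<times> A. ?bad z x})"
  proof (intro sum.cong refl)
    fix z
    have "{x \<in> A \<times> A. ?bad z x} = {v \<in> centres z. \<not> good z v} \<times> centres z"
      by (auto simp: centres_def)
    then show "card {v \<in> centres z. \<not> good z v} * card (centres z) = card {x \<in> A \<times> A. ?bad z x}"
      by (simp add: card_cartesian_product)
  qed
  also have "\<dots> = (\<Sum>x\<in>A \<times> A. card {z \<in> tuples. ?bad z x})"
    using finite_A finite_tuples by (intro sum_card_swap) auto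
  also have "\<dots> \<le> (\<Sum>x\<in>A \<times> A. Suc s * (Suc s * ?L) * card (common x) ^ s)"
  proof (rule sum_mono)
    fix x assume x: "x \<in> A \<times> A"
    let ?S = "\<lambda>i j. {z \<in> PiE {..s} (\<lambda>_. common x). i \<noteq> j \<and> z j \<in> near (fst x) (z i)}"
    have "{z \<in> tuples. ?bad z x} \<subseteq> (\<Union>i\<in>{..s}. \<Union>j\<in>{..s}. ?S i j)"
    proof
      fix z assume z: "z \<in> {z \<in> tuples. ?bad z x}"
      then have "z \<in> PiE {..s} (\<lambda>_. common x)"
        using in_centres_both_iff[of z x] x by (auto simp: tuples_def)
      moreover obtain i j m where ij: "i \<le> s" "j \<le> s" "i \<noteq> j"
        and m: "m \<in> mids (fst x) (z i)" "m \<in> mids (fst x) (z j)"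
        using z by (auto simp: good_def)
      moreover have "z j \<in> A" using ij z tuples_in_A by blast
      then have "z j \<in> near (fst x) (z i)"
        using m by (auto simp: near_def nbr_def mids_def)
      ultimately show "z \<in> (\<Union>i\<in>{..s}. \<Union>j\<in>{..s}. ?S i j)"
        by blast
    qed
    then have "card {z \<in> tuples. ?bad z x} \<le> card (\<Union>i\<in>{..s}. \<Union>j\<in>{..s}. ?S i j)"
      by (intro card_mono) (auto simp: finite_PiE finite_common)
    also have "\<dots> \<le> (\<Sum>i\<le>s. card (\<Union>j\<in>{..s}. ?S i j))"
      by (intro card_UN_le) auto
    also have "\<dots> \<le> (\<Sum>i\<le>s. \<Sum>j\<le>s. card (?S i j))"
      by (intro sum_mono card_UN_le) auto
    also have "\<dots> \<le> (\<Sum>i\<le>s. \<Sum>j\<le>s. ?L * card (common x) ^ (card {..s} - 1))"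
    proof (intro sum_mono)
      fix i j assume ij: "i \<in> {..s}" "j \<in> {..s}"
      show "card (?S i j) \<le> ?L * card (common x) ^ (card {..s} - 1)"
      proof (cases "i = j")
        case False
        show ?thesis
        proof (rule card_PiE_determined_le[where X = "\<lambda>g. near (fst x) (g i)" and j = j])
          fix g assume "g \<in> PiE ({..s} - {j}) (\<lambda>_. common x)"
          then have "g i \<in> common x" using ij False by (auto simp: PiE_def Pi_def)
          then have "light (fst x) (g i)" by (auto simp: common_def light_nbr_def)
          then show "finite (near (fst x) (g i)) \<and> card (near (fst x) (g i)) \<le> ?L"
            using assms by (rule card_near_le)
        qed (use ij False finite_common in auto)
      qed simp
    qed
    finally show "card {z \<in> tuples. ?bad z x} \<le> Suc s * (Suc s * ?L) * card (common x) ^ s"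
      by (simp add: algebra_simps)
  qed
  finally show ?thesis by (simp add: sum_distrib_left)
qed

text \<open>Pairs of good centres are bounded by close pairs and centres through
  \<open>card_good_le\<close>; pairs with a member that is not good are counted directly.\<close>

lemma sum_tuples_centres_squared_le:
  assumes "\<And>b. b \<in> B \<Longrightarrow> card (nbr b) \<le> \<Delta>"
  defines "L \<equiv> card (edges (K_plus s t))"
  defines "Q \<equiv> (t * (Suc s * L))\<^sup>2 * 4 ^ card (verts (K_plus s t))"
  shows "(\<Sum>z\<in>tuples. (card (centres z))\<^sup>2)
    \<le> Q * (Suc s * (L * \<Delta>) * (\<Sum>x\<in>A \<times> A. card (common x) ^ s) + (\<Sum>v\<in>A. card (light_nbr v) ^ Suc s))
      + 2 * (Suc s * (Suc s * (L * \<Delta>)) * (\<Sum>x\<in>A \<times> A. card (common x) ^ s))"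
proof -
  let ?G = "\<lambda>z. card {v \<in> centres z. good z v}"
  let ?N = "\<lambda>z. card {v \<in> centres z. \<not> good z v}"
  have le: "(card (centres z))\<^sup>2 \<le> Q * (card (close_pairs z) + card (centres z)) + 2 * (?N z * card (centres z))"
    if "z \<in> tuples" for z
  proof -
    have "card (centres z) = card ({v \<in> centres z. good z v} \<union> {v \<in> centres z. \<not> good z v})"
      by (intro arg_cong[of _ _ card]) auto
    also have "\<dots> = ?G z + ?N z"
      using finite_centres by (intro card_Un_disjoint) auto
    \<comment> \<open>With \<open>c = g + n\<close>, the square of \<open>c\<close> exceeds that of
      \<open>g\<close> by \<open>2 * g * n + n * n\<close>, which is at most
      \<open>2 * n * c\<close>.\<close>
    finally have "(card (centres z))\<^sup>2 \<le> (?G z)\<^sup>2 + 2 * (?N z * card (centres z))"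
      by (simp add: power2_eq_square algebra_simps)
    then show ?thesis
      using card_good_le[OF that] unfolding Q_def L_def by linarith
  qed
  \<comment> \<open>Dropping the condition on \<open>z 0\<close> and \<open>z 1\<close> only
    enlarges the sum and turns it into a power sum of light degrees.\<close>
  have "(\<Sum>z\<in>tuples. card (centres z)) \<le> (\<Sum>z\<in>PiE {..s} (\<lambda>_. A). card (centres z))"
    using finite_A by (intro sum_mono2) (auto simp: tuples_def finite_PiE)
  then have Z: "(\<Sum>z\<in>tuples. card (centres z)) \<le> (\<Sum>v\<in>A. card (light_nbr v) ^ Suc s)"
    by (simp only: sum_card_centres)
  have "(\<Sum>z\<in>tuples. (card (centres z))\<^sup>2)
      \<le> (\<Sum>z\<in>tuples. Q * (card (close_pairs z) + card (centres z)) + 2 * (?N z * card (centres z)))"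
    by (intro sum_mono le)
  also have "\<dots> = Q * ((\<Sum>z\<in>tuples. card (close_pairs z)) + (\<Sum>z\<in>tuples. card (centres z)))
      + 2 * (\<Sum>z\<in>tuples. ?N z * card (centres z))"
    by (simp only: sum.distrib sum_distrib_left[symmetric])
  also have "\<dots> \<le> Q * (Suc s * (L * \<Delta>) * (\<Sum>x\<in>A \<times> A. card (common x) ^ s) + (\<Sum>v\<in>A. card (light_nbr v) ^ Suc s))
      + 2 * (Suc s * (Suc s * (L * \<Delta>)) * (\<Sum>x\<in>A \<times> A. card (common x) ^ s))"
    unfolding L_def
    by (intro add_mono mult_left_mono sum_close_pairs_le[OF assms(1)] sum_not_good_le[OF assms(1)] Z) auto
  finally show ?thesis .
qed

section \<open>Moments of light degrees and codegrees\<close>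

lemma sum_card_light_nbr: "(\<Sum>v\<in>A. card (light_nbr v)) = card (light_pairs A)"
proof -
  have "light_pairs A = (SIGMA v:A. light_nbr v)"
    by (auto simp: light_pairs_def light_nbr_def)
  then show ?thesis using finite_A finite_light_nbr by simp
qed

text \<open>Walks of length two in the light graph, counted by their ends and by their middle
  vertex.\<close>

lemma sum_card_common: "(\<Sum>x\<in>A \<times> A. card (common x)) = (\<Sum>v\<in>A. (card (light_nbr v))\<^sup>2)"
proof -
  have "(\<Sum>x\<in>A \<times> A. card (common x)) = (\<Sum>x\<in>A \<times> A. card {u \<in> A. light (fst x) u \<and> light (snd x) u})"
    by (intro sum.cong refl arg_cong[of _ _ card]) (auto simp: common_def light_nbr_def)
  also have "\<dots> = (\<Sum>u\<in>A. card {x \<in> A \<times> A. light (fst x) u \<and> light (snd x) u})"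
    using finite_A by (intro sum_card_swap) auto
  also have "\<dots> = (\<Sum>u\<in>A. card (light_nbr u \<times> light_nbr u))"
    by (intro sum.cong refl arg_cong[of _ _ card]) (auto simp: light_nbr_def light_commute)
  finally show ?thesis by (simp add: card_cartesian_product power2_eq_square)
qed

text \<open>With \<open>S k\<close> the sum of \<open>k\<close>-th powers of codegrees and
  \<open>Z\<close> that of \<open>Suc s\<close>-th powers of light degrees, the two counts give
  \<open>p * S (Suc s) \<le> C * \<Delta> * S s + C * Z\<close>. Convexity bounds
  \<open>S (Suc s)\<close> below by multiples of \<open>S s\<close> and of \<open>Z\<close>, so one
  term on the right must be large; these are the two alternatives. The summands of \<open>C\<close>
  come from close pairs, centres, centres that are not good, and the loss
  \<open>\<delta> * card U\<close>.\<close>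

lemma density_bound:
  fixes \<delta> p :: real and n \<Delta> K L Q C :: nat
  defines "K \<equiv> 4 ^ card (verts (K_plus s t))" and "L \<equiv> card (edges (K_plus s t))"
  defines "Q \<equiv> (t * (Suc s * L))\<^sup>2 * K"
  defines "C \<equiv> Q * (Suc s * L) + Q + 2 * (Suc s * (Suc s * L)) + 1"
  defines "p \<equiv> \<delta>\<^sup>2 / (2 * card B * K * L)"
  assumes card_A: "card A \<le> n" and card_B: "card B \<le> n" "0 < card B"
    and min_deg: "\<And>a. a \<in> A \<Longrightarrow> \<delta> \<le> card {b \<in> B. E a b}"
    and max_deg: "\<And>b. b \<in> B \<Longrightarrow> card (nbr b) \<le> \<Delta>"
    and total: "n * \<delta> \<le> (\<Sum>a\<in>A. real (card {b \<in> B. E a b}))"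
    and \<delta>: "2 * K \<le> \<delta>" "\<delta> \<le> \<Delta>"
  shows "p ^ 3 * n \<le> 2 * C * \<Delta> \<or> p ^ (s + 2) * n \<le> 2 * C"
proof (rule ccontr)
  assume "\<not> ?thesis"
  then have big: "2 * C * real \<Delta> < p ^ 3 * n" "2 * real C < p ^ (s + 2) * n"
    by auto
  define N where "N = real n"
  define S where "S k = (\<Sum>x\<in>A \<times> A. real (card (common x)) ^ k)" for k
  define Z where "Z = (\<Sum>v\<in>A. real (card (light_nbr v)) ^ Suc s)"
  have L_pos: "0 < L"
    using finite_edges_H s_pos by (auto simp: L_def card_gt_0_iff K_plus_def)
  have K_pos: "0 < K" by (simp add: K_def)
  have n_pos: "0 < N" using card_B by (simp add: N_def)
  have A_le: "real (card A) \<le> N" using card_A by (simp add: N_def)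
  have \<delta>_pos: "0 < \<delta>" using \<delta>(1) K_pos by (simp add: less_le_trans)
  have p_pos: "0 < p"
    using \<delta>_pos K_pos L_pos card_B by (simp add: p_def)

  \<comment> \<open>Since \<open>2 * K \<le> \<delta>\<close>, the total \<open>n * \<delta>\<close>
    is large enough for the diagonal term to be absorbed.\<close>
  have "(N * \<delta>)\<^sup>2 / (2 * card B * 4 ^ card (verts (K_plus s t)) * card (edges (K_plus s t)))
      \<le> card (light_pairs A)"
  proof (rule card_light_pairs_ge_of_sum)
    have "real (2 * card B * 4 ^ card (verts (K_plus s t))) = real (card B) * real (2 * K)"
      by (simp add: K_def)
    also have "\<dots> \<le> N * \<delta>"
      using card_B \<delta>(1) by (intro mult_mono) (auto simp: N_def)
    finally show "real (2 * card B * 4 ^ card (verts (K_plus s t))) \<le> N * \<delta>" .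
  qed (use card_B L_pos total in \<open>auto simp: L_def N_def\<close>)
  then have pairs: "p * N\<^sup>2 \<le> (\<Sum>v\<in>A. real (card (light_nbr v)))"
    by (simp add: sum_card_light_nbr[symmetric] p_def K_def L_def power_mult_distrib mult.commute)

  have "(p * N\<^sup>2)\<^sup>2 \<le> (\<Sum>v\<in>A. real (card (light_nbr v)))\<^sup>2"
    using pairs p_pos by (intro power_mono) auto
  also have "\<dots> \<le> card A * S 1"
    using sum_power_ge[OF finite_A, of "\<lambda>v. real (card (light_nbr v))" 1]
      arg_cong[OF sum_card_common, of real]
    by (simp add: S_def numeral_2_eq_2)
  also have "\<dots> \<le> N * S 1"
    using A_le by (intro mult_right_mono) (auto simp: S_def intro!: sum_nonneg)
  finally have "N * (p\<^sup>2 * N ^ 3) \<le> N * S 1"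
    by (simp add: power2_eq_square power3_eq_cube mult_ac)
  then have S1: "p\<^sup>2 * N ^ 3 \<le> S 1"
    using n_pos by simp

  have S_nonneg: "0 \<le> S k" for k by (auto simp: S_def intro!: sum_nonneg)
  \<comment> \<open>Chebyshev's inequality with exponent \<open>s\<close>; over at most
    \<open>N\<^sup>2\<close> pairs the average codegree is at least
    \<open>p\<^sup>2 * N\<close>.\<close>
  have "p\<^sup>2 * N ^ 3 * S s \<le> S s * S 1"
    using S1 S_nonneg[of s] by (simp add: mult.commute mult_left_mono)
  also have "\<dots> \<le> card (A \<times> A) * S (Suc s)"
    unfolding S_def using finite_A sum_power_Suc_ge[of "A \<times> A" "\<lambda>x. real (card (common x))" s] by simp
  also have "\<dots> \<le> N\<^sup>2 * S (Suc s)"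
    using A_le S_nonneg n_pos by (intro mult_right_mono) (auto simp: card_cartesian_product power2_eq_square intro!: mult_mono)
  finally have "N\<^sup>2 * (p\<^sup>2 * N * S s) \<le> N\<^sup>2 * S (Suc s)"
    by (simp add: power2_eq_square power3_eq_cube mult_ac)
  then have S2: "p\<^sup>2 * N * S s \<le> S (Suc s)"
    using n_pos by simp

  have "(p * N\<^sup>2) ^ Suc s \<le> (\<Sum>v\<in>A. real (card (light_nbr v))) ^ Suc s"
    using pairs p_pos by (intro power_mono) auto
  also have "\<dots> \<le> real (card A) ^ s * Z"
    unfolding Z_def using sum_power_ge[OF finite_A, of "\<lambda>v. real (card (light_nbr v))" s] by simp
  also have "\<dots> \<le> N ^ s * Z"
    using A_le by (intro mult_right_mono power_mono) (auto simp: Z_def intro!: sum_nonneg)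
  finally have "N ^ s * (p ^ Suc s * N ^ (s + 2)) \<le> N ^ s * Z"
    by (simp add: power_mult_distrib power_add power2_eq_square mult_ac)
  then have Z1: "p ^ Suc s * N ^ (s + 2) \<le> Z"
    using n_pos by simp
  have Z_pos: "0 < Z"
    by (rule less_le_trans[OF _ Z1]) (use p_pos n_pos in simp)

  \<comment> \<open>Cauchy-Schwarz over all functions into \<open>A\<close>: \<open>Z\<close> is the
    sum of \<open>card (centres z)\<close>, and \<open>S (Suc s)\<close> is the sum of its
    squares.\<close>
  have "Z\<^sup>2 = real ((\<Sum>z\<in>PiE {..s} (\<lambda>_. A). card (centres z))\<^sup>2)"
    by (simp add: sum_card_centres Z_def)
  also have "\<dots> \<le> real (card (PiE {..s} (\<lambda>_. A)) * (\<Sum>z\<in>PiE {..s} (\<lambda>_. A). (card (centres z))\<^sup>2))"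
    using finite_A by (intro of_nat_mono sum_squared_le finite_PiE) auto
  also have "\<dots> = real (card A) ^ Suc s * S (Suc s)"
    by (simp add: sum_card_centres_squared S_def card_PiE)
  also have "\<dots> \<le> N ^ Suc s * S (Suc s)"
    using A_le S_nonneg by (intro mult_right_mono power_mono) auto
  finally have "Z * Z \<le> N ^ Suc s * S (Suc s)"
    by (simp add: power2_eq_square)
  moreover have "p ^ Suc s * N ^ (s + 2) * Z \<le> Z * Z"
    using Z1 Z_pos by (intro mult_right_mono) auto
  ultimately have "N ^ Suc s * (p ^ Suc s * N * Z) \<le> N ^ Suc s * S (Suc s)"
    by (simp add: mult_ac)
  then have S3: "p ^ Suc s * N * Z \<le> S (Suc s)"
    using n_pos by (simp del: power_Suc)

  \<comment> \<open>The density bound on \<open>common x\<close>, multiplied by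
    \<open>card (common x) ^ (s - 1)\<close>.\<close>
  have "p * real (card (common x)) ^ Suc s - \<delta> * real (card (common x)) ^ s
      \<le> real (card (light_pairs (common x)) * card (common x) ^ (s - 1))" for x
  proof -
    have "p * (real (card (common x)))\<^sup>2 - \<delta> * card (common x) \<le> card (light_pairs (common x))"
      using card_light_pairs_ge_min_degree[of "common x" \<delta>] card_B L_pos \<delta>_pos min_deg
      by (auto simp: p_def K_def L_def common_def light_nbr_def)
    then have "(p * (real (card (common x)))\<^sup>2 - \<delta> * card (common x)) * real (card (common x)) ^ (s - 1)
        \<le> real (card (light_pairs (common x))) * real (card (common x)) ^ (s - 1)"
      by (intro mult_right_mono) auto
    then show ?thesis
      using s_pos by (cases s) (auto simp: algebra_simps power2_eq_square)
  qed
  then have "(\<Sum>x\<in>A \<times> A. p * real (card (common x)) ^ Suc s - \<delta> * real (card (common x)) ^ s)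
      \<le> (\<Sum>x\<in>A \<times> A. real (card (light_pairs (common x)) * card (common x) ^ (s - 1)))"
    by (intro sum_mono) simp
  also have "\<dots> \<le> real (\<Sum>z\<in>tuples. (card (centres z))\<^sup>2)"
    using sum_tuples_centres_squared_ge by (simp only: of_nat_sum[symmetric] of_nat_le_iff)
  also have "\<dots> \<le> real (Q * (Suc s * (L * \<Delta>) * (\<Sum>x\<in>A \<times> A. card (common x) ^ s) + (\<Sum>v\<in>A. card (light_nbr v) ^ Suc s))
      + 2 * (Suc s * (Suc s * (L * \<Delta>)) * (\<Sum>x\<in>A \<times> A. card (common x) ^ s)))"
    using sum_tuples_centres_squared_le[OF max_deg] unfolding Q_def K_def L_def
    by (simp only: of_nat_le_iff)
  also have "\<dots> = real Q * (real (Suc s) * (L * \<Delta>) * S s + Z) + 2 * (real (Suc s) * (Suc s * (L * \<Delta>)) * S s)"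
    by (simp add: S_def Z_def algebra_simps)
  finally have "p * S (Suc s) - \<delta> * S s \<le> \<dots>"
    by (simp add: S_def sum_subtractf sum_distrib_left)
  \<comment> \<open>The loss joins the terms with \<open>\<Delta>\<close>; the summand 1 in
    \<open>C\<close> pays for it.\<close>
  moreover have "\<delta> * S s \<le> \<Delta> * S s"
    using \<delta>(2) S_nonneg by (rule mult_right_mono)
  ultimately have "p * S (Suc s) \<le> real Q * (real (Suc s) * L) * (\<Delta> * S s) + Q * Z
      + 2 * (real (Suc s) * (real (Suc s) * L)) * (\<Delta> * S s) + \<Delta> * S s"
    by (simp add: algebra_simps)
  also have "\<dots> \<le> C * (\<Delta> * S s) + C * Z"
    using S_nonneg[of s] Z_pos by (simp add: C_def algebra_simps)
  finally have upper: "p * S (Suc s) \<le> C * \<Delta> * S s + C * Z"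
    by simp

  \<comment> \<open>As both alternatives fail, each term on the right of \<open>upper\<close> is at
    most half of \<open>p * S (Suc s)\<close>, the second one strictly less.\<close>
  have "2 * C * \<Delta> * S s \<le> p ^ 3 * N * S s"
    using big(1) S_nonneg by (intro mult_right_mono) (auto simp: N_def)
  also have "\<dots> = p * (p\<^sup>2 * N * S s)"
    by (simp add: power2_eq_square power3_eq_cube)
  also have "\<dots> \<le> p * S (Suc s)"
    using S2 p_pos by (intro mult_left_mono) auto
  finally have 1: "2 * C * \<Delta> * S s \<le> p * S (Suc s)" .
  have "2 * C * Z < p ^ (s + 2) * N * Z"
    using big(2) Z_pos by (intro mult_strict_right_mono) (auto simp: N_def)
  also have "\<dots> = p * (p ^ Suc s * N * Z)"
    by simp
  also have "\<dots> \<le> p * S (Suc s)"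
    using S3 p_pos by (intro mult_left_mono) auto
  finally show False using 1 upper by linarith
qed

end

section \<open>Reduction to the bipartite setting\<close>

text \<open>Induction on the vertices: each new vertex goes to the side that cuts at least half of
  its edges.\<close>

lemma ex_large_cut:
  assumes "finite V" "\<And>e. e \<in> E \<Longrightarrow> e \<subseteq> V \<and> card e = 2"
  shows "\<exists>X\<subseteq>V. card E \<le> 2 * card {e \<in> E. \<exists>a\<in>X. \<exists>b\<in>V - X. e = {a, b}}"
  using assms
proof (induction V arbitrary: E)
  case empty
  then have "E = {}" by fastforce
  then show ?case by simp
next
  case (insert v V)
  let ?cut = "\<lambda>X V E. {e \<in> E. \<exists>a\<in>X. \<exists>b\<in>V - X. e = {a, b}}"
  have finE: "finite E"
    using insert.prems insert.hyps(1) by (intro finite_subset[of E "Pow (insert v V)"]) auto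
  define E1 where "E1 = {e \<in> E. v \<notin> e}"
  have E1: "e \<subseteq> V \<and> card e = 2" if "e \<in> E1" for e
    using insert.prems[of e] that by (auto simp: E1_def)
  obtain X where X: "X \<subseteq> V" "card E1 \<le> 2 * card (?cut X V E1)"
    using insert.IH[OF E1] by blast
  define E2 where "E2 = {e \<in> E. v \<in> e \<and> e \<inter> X \<noteq> {}}"
  define E3 where "E3 = {e \<in> E. v \<in> e \<and> e \<inter> X = {}}"
  have fin: "finite E1" "finite E2" "finite E3"
    using finE by (auto simp: E1_def E2_def E3_def)
  have "E = E1 \<union> (E2 \<union> E3)" by (auto simp: E1_def E2_def E3_def)
  then have card_E: "card E \<le> card E1 + (card E2 + card E3)"
    using card_Un_le[of E1 "E2 \<union> E3"] card_Un_le[of E2 E3] by simp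
  have other: "\<exists>u\<in>V. e = {v, u}" if e: "e \<in> E" "v \<in> e" for e
  proof -
    obtain x y where xy: "e = {x, y}" "x \<noteq> y"
      using insert.prems[OF e(1)] by (auto simp: card_2_iff)
    then show ?thesis
      using e(2) insert.prems[OF e(1)] by (cases "v = x") auto
  qed
  have fin_cut: "finite (?cut X V E1)" using fin(1) by simp
  show ?case
  proof (cases "card E3 \<le> card E2")
    case True
    have "card (?cut X V E1) + card E2 = card (?cut X V E1 \<union> E2)"
      by (rule card_Un_disjoint[OF fin_cut fin(2), symmetric]) (auto simp: E1_def E2_def)
    also have "\<dots> \<le> card (?cut X (insert v V) E)"
    proof (intro card_mono Un_least)
      show "E2 \<subseteq> ?cut X (insert v V) E"
      proof
        fix e assume e: "e \<in> E2"
        then obtain u where "u \<in> V" "e = {v, u}" using other[of e] by (auto simp: E2_def)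
        then show "e \<in> ?cut X (insert v V) E"
          using e X(1) insert.hyps(2) by (fastforce simp: E2_def)
      qed
    qed (use finE in \<open>auto simp: E1_def\<close>)
    finally show ?thesis
      using True X card_E by (intro exI[of _ X]) auto
  next
    case False
    have "card (?cut X V E1) + card E3 = card (?cut X V E1 \<union> E3)"
      by (rule card_Un_disjoint[OF fin_cut fin(3), symmetric]) (auto simp: E1_def E3_def)
    also have "\<dots> \<le> card (?cut (insert v X) (insert v V) E)"
    proof (intro card_mono Un_least)
      show "E3 \<subseteq> ?cut (insert v X) (insert v V) E"
      proof
        fix e assume e: "e \<in> E3"
        then obtain u where "u \<in> V" "e = {v, u}" using other[of e] by (auto simp: E3_def)
        then show "e \<in> ?cut (insert v X) (insert v V) E"
          using e X(1) insert.hyps(2) by (auto simp: E3_def)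
      qed
      show "?cut X V E1 \<subseteq> ?cut (insert v X) (insert v V) E"
        using insert.hyps(2) by (auto simp: E1_def)
    qed (use finE in auto)
    finally show ?thesis
      using False X card_E by (intro exI[of _ "insert v X"]) auto
  qed
qed

text \<open>Pigeonhole over the classes \<open>i < k\<close>; elements with \<open>f b = 0\<close>
  lie in no class and contribute nothing.\<close>

lemma ex_dyadic_class:
  fixes f :: "'a \<Rightarrow> nat"
  assumes "finite B" "\<And>b. b \<in> B \<Longrightarrow> f b < 2 ^ k" "0 < k"
  shows "\<exists>i. sum f B \<le> k * sum f {b \<in> B. 2 ^ i \<le> f b \<and> f b < 2 ^ Suc i}"
proof (rule ccontr)
  let ?B = "\<lambda>i. {b \<in> B. 2 ^ i \<le> f b \<and> f b < 2 ^ Suc i}"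
  assume "\<not> ?thesis"
  then have less: "k * sum f (?B i) < sum f B" for i
    by (auto simp: not_le)
  have "sum f B \<le> (\<Sum>b\<in>B. \<Sum>i<k. if 2 ^ i \<le> f b \<and> f b < 2 ^ Suc i then f b else 0)"
  proof (rule sum_mono)
    fix b assume b: "b \<in> B"
    show "f b \<le> (\<Sum>i<k. if 2 ^ i \<le> f b \<and> f b < 2 ^ Suc i then f b else 0)"
    proof (cases "f b = 0")
      case False
      then obtain i where i: "2 ^ i \<le> f b" "f b < 2 ^ Suc i"
        using ex_power_ivl1[of 2 "f b"] by auto
      have "(2::nat) ^ i < 2 ^ k" using i(1) assms(2)[OF b] by linarith
      then have "i \<in> {..<k}" by simp
      then have "(if 2 ^ i \<le> f b \<and> f b < 2 ^ Suc i then f b else 0)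
          \<le> (\<Sum>i<k. if 2 ^ i \<le> f b \<and> f b < 2 ^ Suc i then f b else 0)"
        by (intro member_le_sum) auto
      then show ?thesis using i by simp
    qed simp
  qed
  also have "\<dots> = (\<Sum>i<k. sum f (?B i))"
    using assms(1) by (subst sum.swap) (intro sum.cong refl sum.inter_filter[symmetric])
  finally have "k * sum f B \<le> k * (\<Sum>i<k. sum f (?B i))"
    by (rule mult_left_mono) simp
  also have "\<dots> = (\<Sum>i<k. k * sum f (?B i))"
    by (rule sum_distrib_left)
  also have "\<dots> < (\<Sum>i<k. sum f B)"
    using less assms(3) by (intro sum_strict_mono) auto
  finally show False by simp
qed

text \<open>The cut costs a factor 2 and the dyadic class a factor \<open>k\<close>, so
  \<open>\<delta>\<^sub>0 \<le> \<delta>\<close> for \<open>\<delta> = m / (2 * n)\<close>, where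
  \<open>m\<close> edges remain between \<open>X\<close> and \<open>B\<close>. Both alternatives of
  \<open>density_bound\<close> are then restated through
  \<open>\<delta>\<^sub>0 \<le> \<delta> \<le> D\<close>.\<close>

lemma edge_density_bound:
  fixes G :: "'a graph" and \<delta>\<^sub>0 :: real and s t K L Q C :: nat
  defines "K \<equiv> 4 ^ card (verts (K_plus s t))" and "L \<equiv> card (edges (K_plus s t))"
  defines "Q \<equiv> (t * (Suc s * L))\<^sup>2 * K"
  defines "C \<equiv> Q * (Suc s * L) + Q + 2 * (Suc s * (Suc s * L)) + 1"
  assumes "0 < s" "0 < t" and G: "simple_graph G" "card (verts G) = n"
    and free: "\<not> contains_copy G (subdivision (K_plus s t))"
    and k: "n < 2 ^ k" "0 < k" "0 < n"
    and \<delta>\<^sub>0: "4 * real k * real n * \<delta>\<^sub>0 \<le> card (edges G)" "2 * real K \<le> \<delta>\<^sub>0"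
  shows "\<delta>\<^sub>0 ^ 5 \<le> 256 * C * (K * L) ^ 3 * (real n)\<^sup>2
    \<or> (\<delta>\<^sub>0\<^sup>2 / (4 * n * K * L)) ^ (s + 2) * n \<le> 2 * C"
proof -
  define V where "V = verts G"
  have finV: "finite V" and edgesG: "\<And>e. e \<in> edges G \<Longrightarrow> e \<subseteq> V \<and> card e = 2"
    using G(1) by (auto simp: simple_graph_def V_def)
  obtain X where X: "X \<subseteq> V"
    "card (edges G) \<le> 2 * card {e \<in> edges G. \<exists>a\<in>X. \<exists>b\<in>V - X. e = {a, b}}"
    using ex_large_cut[OF finV edgesG] by blast
  have finX: "finite X" using X(1) finV finite_subset by blast
  define E where "E a b \<longleftrightarrow> {a, b} \<in> edges G" for a b
  define deg where "deg b = card {a \<in> X. E a b}" for b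
  have deg_le: "deg b \<le> n" for b
    unfolding deg_def using card_mono[OF finV, of "{a \<in> X. E a b}"] X(1) G(2) by (auto simp: V_def)
  let ?P = "SIGMA b:V - X. {a \<in> X. E a b}"
  have "{e \<in> edges G. \<exists>a\<in>X. \<exists>b\<in>V - X. e = {a, b}} \<subseteq> (\<lambda>(b, a). {a, b}) ` ?P"
    by (force simp: E_def)
  then have "card {e \<in> edges G. \<exists>a\<in>X. \<exists>b\<in>V - X. e = {a, b}} \<le> card ?P"
    using finX finV by (intro surj_card_le) auto
  also have "\<dots> = sum deg (V - X)"
    unfolding deg_def using finX finV by (intro card_SigmaI) auto
  finally have e1: "card (edges G) \<le> 2 * sum deg (V - X)"
    using X(2) by linarith
  obtain i where i: "sum deg (V - X) \<le> k * sum deg {b \<in> V - X. 2 ^ i \<le> deg b \<and> deg b < 2 ^ Suc i}"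
    using ex_dyadic_class[of "V - X" deg k] finV deg_le k le_less_trans by blast
  define B where "B = {b \<in> V - X. 2 ^ i \<le> deg b \<and> deg b < 2 ^ Suc i}"
  define D where "D = real (2 ^ i)"
  define m where "m = sum deg B"
  \<comment> \<open>The vertices of \<open>X\<close> with degree below this \<open>\<delta>\<close>
    carry at most \<open>n * \<delta>\<close> edges, half of all \<open>m\<close>, so discarding
    them keeps the other half.\<close>
  define \<delta> where "\<delta> = real m / (2 * n)"
  define \<beta> where "\<beta> = real (card B)"
  have finB: "finite B" using finV by (simp add: B_def)
  have card_B: "card B \<le> n"
    using card_mono[OF finV, of B] G(2) by (auto simp: B_def V_def)
  have m: "m = 2 * n * \<delta>" using k(3) by (simp add: \<delta>_def)
  have "card (edges G) \<le> 2 * (k * m)"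
    using e1 i unfolding m_def B_def by linarith
  then have "4 * real k * real n * \<delta>\<^sub>0 \<le> real (2 * (k * m))"
    using \<delta>\<^sub>0(1) by (meson of_nat_mono order.trans)
  also have "\<dots> = 4 * real k * real n * \<delta>" using m by simp
  finally have \<delta>_ge: "\<delta>\<^sub>0 \<le> \<delta>" using k by simp
  have K_pos: "0 < K" by (simp add: K_def)
  have \<delta>_pos: "0 < \<delta>" "0 < \<delta>\<^sub>0" using \<delta>\<^sub>0(2) \<delta>_ge K_pos by linarith+
  \<comment> \<open>Degrees in \<open>B\<close> are at least \<open>D\<close>, so \<open>B\<close>
    is small when \<open>D\<close> is large, and a small \<open>B\<close> raises
    \<open>p\<close>.\<close>
  have "\<beta> * D = real (\<Sum>b\<in>B. 2 ^ i)" by (simp add: \<beta>_def D_def)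
  also have "\<dots> \<le> m"
    unfolding m_def by (intro of_nat_mono sum_mono) (auto simp: B_def)
  finally have \<beta>_le: "\<beta> * D \<le> 2 * n * \<delta>" using m by simp
  have "m \<le> (\<Sum>b\<in>B. 2 ^ Suc i)"
    unfolding m_def by (intro sum_mono) (auto simp: B_def)
  then have "real m \<le> real (card B * 2 ^ Suc i)"
    by (simp only: sum_constant of_nat_id of_nat_le_iff)
  then have "n * (2 * \<delta>) \<le> \<beta> * (2 * D)"
    using m by (simp add: \<beta>_def D_def mult_ac)
  also have "\<dots> \<le> n * (2 * D)"
    using card_B by (intro mult_right_mono) (auto simp: \<beta>_def D_def)
  finally have \<delta>_le: "\<delta> \<le> D" using k(3) by simp
  have \<beta>_pos: "0 < \<beta>"
  proof (rule ccontr)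
    assume "\<not> 0 < \<beta>"
    then have "B = {}" using finB by (auto simp: \<beta>_def)
    then show False using \<delta>_pos by (simp add: \<delta>_def m_def)
  qed
  define A where "A = {a \<in> X. \<delta> \<le> card {b \<in> B. E a b}}"
  have sum_X: "(\<Sum>a\<in>X. card {b \<in> B. E a b}) = m"
    unfolding m_def deg_def using finX finB by (rule sum_card_swap)
  have "real m = (\<Sum>a\<in>X. real (card {b \<in> B. E a b}))"
    using arg_cong[OF sum_X, of real] by simp
  also have "\<dots> = (\<Sum>a\<in>A. real (card {b \<in> B. E a b})) + (\<Sum>a\<in>X - A. real (card {b \<in> B. E a b}))"
    using finX by (subst sum.subset_diff[of A X]) (auto simp: A_def)
  also have "(\<Sum>a\<in>X - A. real (card {b \<in> B. E a b})) \<le> (\<Sum>a\<in>X - A. \<delta>)"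
    by (intro sum_mono) (auto simp: A_def)
  also have "\<dots> \<le> n * \<delta>"
    using \<delta>_pos card_mono[OF finV, of "X - A"] X(1) G(2) by (auto simp: V_def intro!: mult_right_mono)
  finally have total: "n * \<delta> \<le> (\<Sum>a\<in>A. real (card {b \<in> B. E a b}))"
    using m by (simp add: mult.commute)

  interpret K_plus_free A B E s t
  proof
    show "finite A" using finX by (simp add: A_def)
    show "simple_graph (K_plus s t)" using \<open>0 < s\<close> by (rule simple_graph_K_plus)
    show "\<not> has_subdivision A B E (K_plus s t)"
    proof
      assume "has_subdivision A B E (K_plus s t)"
      then have "contains_copy G (subdivision (K_plus s t))"
      proof (rule contains_copy_subdivision)
        show "A \<inter> B = {}" "A \<union> B \<subseteq> verts G" using X(1) by (auto simp: A_def B_def V_def)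
      qed (use simple_graph_K_plus[OF \<open>0 < s\<close>, of t] in \<open>auto simp: E_def simple_graph_def\<close>)
      then show False using free by simp
    qed
  qed (use finB assms in auto)
  define p where "p = \<delta>\<^sup>2 / (2 * card B * K * L)"
  have L_pos: "0 < L"
    using finite_edges_H s_pos by (auto simp: L_def card_gt_0_iff K_plus_def)
  have bound: "p ^ 3 * n \<le> 2 * C * (2 * D) \<or> p ^ (s + 2) * n \<le> 2 * C"
  proof -
    have "p ^ 3 * n \<le> real (2 * C * 2 ^ Suc i) \<or> p ^ (s + 2) * n \<le> 2 * C"
      unfolding p_def C_def Q_def K_def L_def
    proof (rule density_bound)
      show "card A \<le> n"
        using card_mono[OF finV, of A] X(1) G(2) by (auto simp: A_def V_def)
      \<comment> \<open>Passing from \<open>X\<close> to \<open>A\<close> only lowers degrees in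
        \<open>B\<close>, so the dyadic upper bound persists.\<close>
      show "card (nbr b) \<le> 2 ^ Suc i" if "b \<in> B" for b
      proof -
        have "card (nbr b) \<le> deg b"
          unfolding deg_def nbr_def using finX by (intro card_mono) (auto simp: A_def)
        then show ?thesis using that by (auto simp: B_def)
      qed
      show "real (2 * 4 ^ card (verts (K_plus s t))) \<le> \<delta>"
        using \<delta>\<^sub>0(2) \<delta>_ge by (simp add: K_def)
      show "\<delta> \<le> real (2 ^ Suc i)"
        using \<delta>_le \<delta>_pos by (simp add: D_def)
    qed (use card_B \<beta>_pos total in \<open>auto simp: \<beta>_def A_def\<close>)
    then show ?thesis by (simp add: D_def)
  qed
  have D_pos: "0 < D" by (simp add: D_def)
  have KL: "0 < real K * real L" using K_pos L_pos by simp
  \<comment> \<open>The size bound on \<open>B\<close> gives \<open>p\<close> a factor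
    \<open>D\<close>, which outweighs the maximum degree in the first alternative.\<close>
  have p_ge: "\<delta> * D / (4 * n * K * L) \<le> p"
  proof -
    have "\<delta> * (\<beta> * D) \<le> \<delta> * (2 * n * \<delta>)"
      using \<beta>_le \<delta>_pos by (intro mult_left_mono) auto
    then have "(\<delta> * D) * (2 * \<beta>) \<le> \<delta>\<^sup>2 * (4 * n)"
      by (simp add: power2_eq_square algebra_simps)
    then have "(\<delta> * D) / (4 * n) \<le> \<delta>\<^sup>2 / (2 * \<beta>)"
      using k(3) \<beta>_pos by (simp add: divide_simps mult_ac)
    then have "(\<delta> * D) / (4 * n) / (real K * real L) \<le> \<delta>\<^sup>2 / (2 * \<beta>) / (real K * real L)"
      using KL by (intro divide_right_mono) auto
    then show ?thesis by (simp add: p_def \<beta>_def mult.assoc)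
  qed
  from bound show ?thesis
  proof
    assume 1: "p ^ 3 * n \<le> 2 * C * (2 * D)"
    define R where "R = 4 * real n * real K * real L"
    have R: "0 < R" using K_pos L_pos k(3) by (simp add: R_def)
    have "(\<delta> * D / R) ^ 3 * n \<le> p ^ 3 * n"
      using p_ge \<delta>_pos D_pos R by (intro mult_right_mono power_mono) (auto simp: R_def)
    also have "\<dots> \<le> 4 * C * D"
      using 1 by simp
    finally have "(\<delta> * D) ^ 3 * n \<le> (4 * C * D) * R ^ 3"
      using R by (simp add: power_divide divide_simps mult_ac)
    \<comment> \<open>The constant 256 is \<open>4 * 4 ^ 3\<close>. Cancelling \<open>D * n\<close>
      leaves \<open>\<delta> ^ 3 * D\<^sup>2\<close>, which is at least
      \<open>\<delta>\<^sub>0 ^ 5\<close>.\<close>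
    then have "(D * n) * (\<delta> ^ 3 * D\<^sup>2) \<le> (D * n) * (256 * C * (K * L) ^ 3 * (real n)\<^sup>2)"
      by (simp add: R_def power_mult_distrib power2_eq_square power3_eq_cube algebra_simps)
    then have "\<delta> ^ 3 * D\<^sup>2 \<le> 256 * C * (K * L) ^ 3 * (real n)\<^sup>2"
      using D_pos k(3) by (subst (asm) mult_le_cancel_left_pos) auto
    moreover have "\<delta>\<^sub>0 ^ 3 * \<delta>\<^sub>0\<^sup>2 \<le> \<delta> ^ 3 * D\<^sup>2"
      using \<delta>_ge \<delta>_le \<delta>_pos by (intro mult_mono power_mono) auto
    ultimately show ?thesis by (simp flip: power_add)
  next
    assume 2: "p ^ (s + 2) * n \<le> 2 * C"
    have "\<delta>\<^sub>0\<^sup>2 \<le> \<delta> * D"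
      unfolding power2_eq_square using \<delta>_ge \<delta>_le \<delta>_pos by (intro mult_mono) auto
    then have "\<delta>\<^sub>0\<^sup>2 / (4 * n * K * L) \<le> \<delta> * D / (4 * n * K * L)"
      by (intro divide_right_mono) auto
    then have "\<delta>\<^sub>0\<^sup>2 / (4 * n * K * L) \<le> p"
      using p_ge by linarith
    then have "(\<delta>\<^sub>0\<^sup>2 / (4 * n * K * L)) ^ (s + 2) * n \<le> p ^ (s + 2) * n"
      by (intro mult_right_mono power_mono) auto
    then show ?thesis using 2 by linarith
  qed
qed

section \<open>Exponents and the final bound\<close>

lemma powr_le_imp_le:
  fixes x a M :: real
  assumes "0 < a" "0 \<le> x" "x powr a \<le> M"
  shows "x \<le> M powr (1 / a)"
proof -
  have "x = (x powr a) powr (1 / a)"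
    using assms(1,2) by (simp add: powr_powr)
  also have "\<dots> \<le> M powr (1 / a)"
    using assms by (intro powr_mono2) auto
  finally show ?thesis .
qed

lemma card_edges_le_square:
  assumes "simple_graph G"
  shows "card (edges G) \<le> (card (verts G))\<^sup>2"
proof -
  have "edges G \<subseteq> (\<lambda>(a, b). {a, b}) ` (verts G \<times> verts G)"
    using assms by (force simp: simple_graph_def card_2_iff)
  then have "card (edges G) \<le> card (verts G \<times> verts G)"
    using assms by (intro surj_card_le) (auto simp: simple_graph_def)
  then show ?thesis by (simp add: card_cartesian_product power2_eq_square)
qed

text \<open>Apply \<open>edge_density_bound\<close> with \<open>n powr \<gamma> / c\<close> for
  \<open>\<delta>\<^sub>0\<close>. Either alternative then bounds a positive power of
  \<open>n\<close>, so a graph exceeding the claimed number of edges has at most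
  \<open>n\<^sub>0\<close> vertices, where the trivial quadratic bound suffices.\<close>

lemma subdivision_K_plus_free_edges_le:
  fixes s t :: nat
  assumes "3 \<le> s" and "0 < t"
  shows "\<exists>C::real. \<forall>(n::nat) (G::'a graph).
             simple_graph G \<and> card (verts G) = n \<and> \<not> contains_copy G (subdivision (K_plus s t))
             \<longrightarrow> real (card (edges G))
                   \<le> C * real n powr (1 + (real s ^ 2 + 1) / (2 * real s + 2 * real s ^ 2))"
proof -
  define K :: nat where "K = 4 ^ card (verts (K_plus s t))"
  define L where "L = card (edges (K_plus s t))"
  define Q where "Q = (t * (Suc s * L))\<^sup>2 * K"
  define C where "C = Q * (Suc s * L) + Q + 2 * (Suc s * (Suc s * L)) + 1"
  define S where "S = real s"
  define \<alpha> where "\<alpha> = (S\<^sup>2 + 1) / (2 * S + 2 * S\<^sup>2)"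
  \<comment> \<open>This slack pays for the logarithmic factor \<open>k\<close>. With
    \<open>\<alpha>\<close> in place of \<open>\<gamma>\<close>, the quantity
    \<open>(2 * \<gamma> - 1) * (S + 2) + 1\<close> would be \<open>2 / (S * (S + 1))\<close>, and
    \<open>\<epsilon>\<close> takes half of that.\<close>
  define \<epsilon> where "\<epsilon> = 1 / (2 * S * (S + 1) * (S + 2))"
  define \<gamma> where "\<gamma> = \<alpha> - \<epsilon>"
  have S: "3 \<le> S" using assms(1) by (simp add: S_def)
  have \<epsilon>: "0 < \<epsilon>" using S by (simp add: \<epsilon>_def)
  have \<alpha>: "0 < \<alpha>" using S by (simp add: \<alpha>_def add_nonneg_pos)
  have ne: "S \<noteq> 0" "S + 1 \<noteq> 0" "S + 2 \<noteq> 0" using S by auto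
  have \<alpha>_eq: "\<alpha> = (S\<^sup>2 + 1) / (2 * (S * (S + 1)))"
    by (simp add: \<alpha>_def power2_eq_square algebra_simps)
  have "5 * \<gamma> - 2 = (S * (S - 3) * (S + 1) + 5) / (2 * S * (S + 1) * (S + 2))"
    using ne by (simp add: \<gamma>_def \<alpha>_eq \<epsilon>_def divide_simps) (simp add: power2_eq_square algebra_simps)
  \<comment> \<open>The assumption \<open>3 \<le> s\<close> enters through the factor
    \<open>S - 3\<close>.\<close>
  also have "\<dots> > 0"
    using S by (intro divide_pos_pos add_nonneg_pos mult_nonneg_nonneg mult_pos_pos) auto
  finally have \<gamma>1: "0 < 5 * \<gamma> - 2" .
  have "(2 * \<gamma> - 1) * (S + 2) + 1 = 1 / (S * (S + 1))"
    using ne by (simp add: \<gamma>_def \<alpha>_eq \<epsilon>_def divide_simps) (simp add: power2_eq_square algebra_simps)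
  then have \<gamma>2: "0 < (2 * \<gamma> - 1) * (S + 2) + 1"
    using S by simp
  \<comment> \<open>Chosen so that \<open>4 * real k \<le> c * n powr \<epsilon>\<close>:
    \<open>k\<close> exceeds \<open>log 2 n\<close> by at most 1, and the logarithm is at most
    \<open>n powr \<epsilon> / (\<epsilon> * ln 2)\<close>.\<close>
  define c where "c = 4 * (1 + 1 / (\<epsilon> * ln 2))"
  have c: "0 < c" using \<epsilon> by (simp add: c_def add_pos_pos)
  have "edges (K_plus s t) \<noteq> {}" by (auto simp: K_plus_def)
  moreover have "finite (edges (K_plus s t))"
    by (rule finite_subset[of _ "Pow (verts (K_plus s t))"]) (use assms in \<open>auto simp: K_plus_def\<close>)
  ultimately have KL: "0 < K" "0 < L" by (simp_all add: K_def L_def card_gt_0_iff)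
  define R where "R = 4 * c\<^sup>2 * K * L"
  have R: "0 < R" using KL c by (simp add: R_def)
  \<comment> \<open>The last three entries bound \<open>n\<close> when
    \<open>\<delta> < 2 * K\<close> and in the two alternatives of
    \<open>edge_density_bound\<close>; the entry 1 makes \<open>n\<^sub>0\<^sup>2\<close> at least
    1.\<close>
  define n\<^sub>0 where "n\<^sub>0 = Max {1, (2 * K * c) powr (1 / \<gamma>),
      (c ^ 5 * (256 * C * (K * L) ^ 3)) powr (1 / (5 * \<gamma> - 2)),
      (2 * C * R ^ (s + 2)) powr (1 / ((2 * \<gamma> - 1) * (S + 2) + 1))}"
  have small: "real n \<le> n\<^sub>0"
    if G: "simple_graph G" "card (verts G) = n" "\<not> contains_copy G (subdivision (K_plus s t))"
      and n: "1 \<le> n" and e: "real n powr (1 + \<alpha>) \<le> card (edges G)" for n and G :: "'a graph"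
  proof -
    define x where "x = real n"
    have x: "1 \<le> x" using n by (simp add: x_def)
    define \<delta> where "\<delta> = x powr \<gamma> / c"
    \<comment> \<open>One more than the integer part of the logarithm, so that
      \<open>n < 2 ^ k\<close> holds strictly, as the dyadic classes require.\<close>
    define k where "k = nat \<lfloor>log 2 x\<rfloor> + 1"
    have log_nonneg: "0 \<le> log 2 x" using x by simp
    have k_pos: "0 < k" by (simp add: k_def)
    have k_le: "real k \<le> log 2 x + 1"
      using log_nonneg by (simp add: k_def)
    have "log 2 x < real k"
      using log_nonneg unfolding k_def by linarith
    then have "x < 2 powr real k" using x by (simp add: log_less_iff)
    then have "real n < real (2 ^ k)" by (simp add: powr_realpow x_def)
    then have n_less: "n < 2 ^ k" by (simp only: of_nat_less_iff)
    have "log 2 x = ln x / ln 2" by (simp add: log_def)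
    also have "\<dots> \<le> (x powr \<epsilon> / \<epsilon>) / ln 2"
      using ln_powr_bound[OF x \<epsilon>] by (intro divide_right_mono) auto
    finally have "real k \<le> x powr \<epsilon> * (1 / (\<epsilon> * ln 2)) + x powr \<epsilon>"
      using k_le ge_one_powr_ge_zero[of x \<epsilon>] x \<epsilon> by simp
    then have "4 * real k \<le> 4 * (x powr \<epsilon> * (1 / (\<epsilon> * ln 2)) + x powr \<epsilon>)"
      by (rule mult_left_mono) simp
    also have "\<dots> = c * x powr \<epsilon>"
      by (simp add: c_def algebra_simps)
    finally have "4 * real k \<le> c * x powr \<epsilon>" .
    then have "4 * real k * (x * \<delta>) \<le> c * x powr \<epsilon> * (x * \<delta>)"
      using x c by (intro mult_right_mono) (auto simp: \<delta>_def)
    also have "\<dots> = x powr (\<epsilon> + 1 + \<gamma>)"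
      using x c by (simp add: \<delta>_def powr_add)
    also have "\<dots> = x powr (1 + \<alpha>)" by (simp add: \<gamma>_def)
    finally have dens: "4 * real k * real n * \<delta> \<le> card (edges G)"
      using e by (simp add: x_def mult.assoc)
    have "x \<le> (2 * K * c) powr (1 / \<gamma>)
        \<or> x \<le> (c ^ 5 * (256 * C * (K * L) ^ 3)) powr (1 / (5 * \<gamma> - 2))
        \<or> x \<le> (2 * C * R ^ (s + 2)) powr (1 / ((2 * \<gamma> - 1) * (S + 2) + 1))"
    proof (cases "2 * real K \<le> \<delta>")
      case False
      then have "x powr \<gamma> \<le> 2 * K * c" using c by (simp add: \<delta>_def divide_simps split: if_splits)
      then show ?thesis using powr_le_imp_le[of \<gamma> x] \<gamma>1 x by auto
    next
      case True
      have "\<delta> ^ 5 \<le> 256 * C * (K * L) ^ 3 * (real n)\<^sup>2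
          \<or> (\<delta>\<^sup>2 / (4 * n * K * L)) ^ (s + 2) * n \<le> 2 * C"
        unfolding C_def Q_def K_def L_def
        by (rule edge_density_bound[where k = k and G = G])
           (use assms G n n_less dens True k_pos in \<open>auto simp: K_def\<close>)
      then show ?thesis
      proof
        assume "\<delta> ^ 5 \<le> 256 * C * (K * L) ^ 3 * (real n)\<^sup>2"
        then have "(x powr \<gamma>) ^ 5 \<le> c ^ 5 * (256 * C * (K * L) ^ 3) * x\<^sup>2"
          using c by (simp add: \<delta>_def power_divide divide_simps x_def mult_ac)
        moreover have "(x powr \<gamma>) ^ 5 = x powr (5 * \<gamma> - 2) * x\<^sup>2"
          using x by (simp add: powr_power powr_diff mult.commute)
        ultimately have "x powr (5 * \<gamma> - 2) \<le> c ^ 5 * (256 * C * (K * L) ^ 3)"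
          using x by simp
        then show ?thesis using powr_le_imp_le[OF \<gamma>1, of x] x by auto
      next
        assume 2: "(\<delta>\<^sup>2 / (4 * n * K * L)) ^ (s + 2) * n \<le> 2 * C"
        have "\<delta>\<^sup>2 / (4 * n * K * L) = x powr (2 * \<gamma> - 1) / R"
          using x c by (simp add: \<delta>_def R_def x_def power_divide powr_diff powr_power mult.commute)
        then have "(\<delta>\<^sup>2 / (4 * n * K * L)) ^ (s + 2) * n
            = (x powr (2 * \<gamma> - 1)) ^ (s + 2) * x / R ^ (s + 2)"
          by (simp add: power_divide x_def)
        also have "(x powr (2 * \<gamma> - 1)) ^ (s + 2) * x = x powr ((2 * \<gamma> - 1) * (S + 2) + 1)"
        proof -
          have "(x powr (2 * \<gamma> - 1)) ^ (s + 2) = x powr ((2 * \<gamma> - 1) * (S + 2))"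
            by (subst powr_power) (use x in \<open>auto simp: S_def algebra_simps\<close>)
          then show ?thesis using x by (simp add: powr_add)
        qed
        finally have "x powr ((2 * \<gamma> - 1) * (S + 2) + 1) \<le> 2 * C * R ^ (s + 2)"
          using 2 R by (simp add: divide_le_eq)
        then show ?thesis using powr_le_imp_le[OF \<gamma>2, of x] x by auto
      qed
    qed
    then show ?thesis
      unfolding n\<^sub>0_def x_def by (auto simp: Max_ge_iff)
  qed
  have n\<^sub>0: "1 \<le> n\<^sub>0" unfolding n\<^sub>0_def by (intro Max_ge) auto
  show ?thesis
  proof (intro exI[of _ "n\<^sub>0\<^sup>2"] allI impI, elim conjE)
    fix n and G :: "'a graph"
    assume G: "simple_graph G" "card (verts G) = n" "\<not> contains_copy G (subdivision (K_plus s t))"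
    have "real (card (edges G)) \<le> n\<^sub>0\<^sup>2 * real n powr (1 + \<alpha>)"
    proof (cases "n = 0 \<or> card (edges G) \<le> real n powr (1 + \<alpha>)")
      case True
      then show ?thesis
      proof
        \<comment> \<open>The value of \<open>0 powr a\<close> is 0, so here the graph must have no
          edges at all.\<close>
        assume "n = 0"
        then show ?thesis using card_edges_le_square[OF G(1)] G(2) by simp
      next
        assume "card (edges G) \<le> real n powr (1 + \<alpha>)"
        also have "\<dots> = 1 * real n powr (1 + \<alpha>)" by simp
        also have "\<dots> \<le> n\<^sub>0\<^sup>2 * real n powr (1 + \<alpha>)"
          using n\<^sub>0 by (intro mult_right_mono one_le_power) auto
        finally show ?thesis .
      qed
    next
      case False
      then have n: "real n \<le> n\<^sub>0" "1 \<le> real n"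
        using small[OF G] by auto
      have "real (card (edges G)) \<le> (real n)\<^sup>2"
        using card_edges_le_square[OF G(1)] G(2) by (metis of_nat_mono of_nat_power)
      also have "\<dots> \<le> n\<^sub>0\<^sup>2 * 1"
        using n by (simp add: power_mono)
      also have "\<dots> \<le> n\<^sub>0\<^sup>2 * real n powr (1 + \<alpha>)"
        using n \<alpha> by (intro mult_left_mono ge_one_powr_ge_zero) auto
      finally show ?thesis .
    qed
    then show "real (card (edges G))
        \<le> n\<^sub>0\<^sup>2 * real n powr (1 + (real s ^ 2 + 1) / (2 * real s + 2 * real s ^ 2))"
      by (simp add: \<alpha>_def S_def)
  qed
qed

theorem theorem1p7:
  fixes s t :: nat
  assumes "3 \<le> s" and "s \<le> t - 1"
  shows "(\<lambda>n. real (ex n (subdivision (K_plus s t))))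
           \<in> O(\<lambda>n. real n powr (1 + (real s ^ 2 + 1) / (2 * real s + 2 * real s ^ 2)))
       \<and> (\<exists>C::real. \<forall>(n::nat) (G::'a graph).
             simple_graph G \<and> card (verts G) = n \<and> \<not> contains_copy G (subdivision (K_plus s t))
             \<longrightarrow> real (card (edges G))
                   \<le> C * real n powr (1 + (real s ^ 2 + 1) / (2 * real s + 2 * real s ^ 2)))"
proof
  let ?F = "subdivision (K_plus s t)"
  have t: "0 < t" using assms by simp
  obtain C where C: "\<And>n (G :: nat graph).
      simple_graph G \<and> card (verts G) = n \<and> \<not> contains_copy G ?F \<Longrightarrow> real (card (edges G))
        \<le> C * real n powr (1 + (real s ^ 2 + 1) / (2 * real s + 2 * real s ^ 2))"
    using subdivision_K_plus_free_edges_le[OF assms(1) t, where 'a = nat] by blast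
  have "real (ex n ?F) \<le> C * real n powr (1 + (real s ^ 2 + 1) / (2 * real s + 2 * real s ^ 2))" for n
  proof -
    \<comment> \<open>The edgeless graph avoids the subdivision, so the maximum runs over a nonempty
      set and is attained.\<close>
    have "ex n ?F \<in> {card (edges G) | G :: nat graph.
        simple_graph G \<and> card (verts G) = n \<and> \<not> contains_copy G ?F}"
      unfolding ex_def
      by (rule Max_in[OF finite_ex_set ex_set_nonempty[OF edges_subdivision_K_plus]])
    then show ?thesis using C by auto
  qed
  then show "(\<lambda>n. real (ex n ?F))
      \<in> O(\<lambda>n. real n powr (1 + (real s ^ 2 + 1) / (2 * real s + 2 * real s ^ 2)))"
    by (intro bigoI[of _ C]) simp
  show "\<exists>C::real. \<forall>(n::nat) (G::'a graph).
      simple_graph G \<and> card (verts G) = n \<and> \<not> contains_copy G ?F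
      \<longrightarrow> real (card (edges G))
            \<le> C * real n powr (1 + (real s ^ 2 + 1) / (2 * real s + 2 * real s ^ 2))"
    by (rule subdivision_K_plus_free_edges_le[OF assms(1) t])
qed

end
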